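(* Let $G$ be a connected 1-plane graph without $\times$-crossings (satisfying the kite-edge standing assumption below), and let $k\ge 1$ be an integer. Then $G$ has a separating set of size at most $k$ if and only if the radial planarization $\Lambda(G)$ has a co-separating triple $(A,X,B)$ such that $|X\cap V(G)|\le k$ and the subgraph of $\Lambda(G)$ induced by $X$ has diameter at most $4k$.
   Context: Graphs are connected, have no loops, and may have parallel edges. A 1-plane graph is a graph $G$ together with a drawing in the plane that is good (edges are simple curves; two edges intersect only at a common endpoint or at a proper crossing; any two edges intersect at most once; no three edges cross at one point) and in which every edge is crossed at most once. For a crossing of edges $(u,v)$ and $(w,x)$, the four distinct vertices $u,v,w,x$ are its endpoints; two endpoints are consecutive if they are not $\{u,v\}$ and not $\{w,x\}$. The crossing is an $\times$-crossing if no two consecutive endpoints are adjacent in $G$. The planarization $G^\times$ is the plane graph obtained by replacing each crossing point by a new dummy vertex adjacent to the four endpoints of that crossing. An edge of $G$ joining consecutive endpoints $u,x$ of a crossing with dummy vertex $c$ is a kite edge if it is uncrossed and $G^\times$ has a face bounded exactly by this edge and the edges $(u,c),(c,x)$. Standing assumption: for every crossing and every pair of consecutive endpoints that are adjacent in $G$, some edge joining them is a kite edge of that crossing. The radial planarization $\Lambda(G)$ is the plane graph obtained from $G^\times$ by inserting a new face vertex $f_F$ inside each face $F$ of $G^\times$ and, for each occurrence of a vertex $v$ on the boundary walk of $F$, an edge $(v,f_F)$ drawn inside $F$ (repeated occurrences give parallel edges). A $G$-vertex is a vertex of $V(G)$. A separating set of $G$ is a set $S\subseteq V(G)$ such that $G-S$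 is disconnected. If $\Lambda$ is a graph sharing some vertices with $G$, a co-separating triple of $\Lambda$ is a partition $(A,X,B)$ of $V(\Lambda)$ such that each of $A,X,B$ contains at least one $G$-vertex, and for all $a\in A$, $b\in B$ there is no edge $(a,b)$ in $E(\Lambda)$ nor in $E(G)$. *)

theory Defs
  imports "HOL-Analysis.Analysis"
begin

text \<open>A multigraph G is given by a vertex set V, an edge set E and endpoint maps
  src, tgt. A drawing places vertex v at the point pos v of the plane (complex numbers)
  and draws edge e as the curve crv e (parametrised over [0,1]).\<close>

definition adjG :: "'e set \<Rightarrow> ('e \<Rightarrow> 'v) \<Rightarrow> ('e \<Rightarrow> 'v) \<Rightarrow> 'v \<Rightarrow> 'v \<Rightarrow> bool" where
  "adjG E src tgt u v \<longleftrightarrow> (\<exists>e\<in>E. (src e = u \<and> tgt e = v) \<or> (src e = v \<and> tgt e = u))"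

definition connected_graph :: "'v set \<Rightarrow> 'e set \<Rightarrow> ('e \<Rightarrow> 'v) \<Rightarrow> ('e \<Rightarrow> 'v) \<Rightarrow> bool" where
  "connected_graph V E src tgt \<longleftrightarrow> V \<noteq> {} \<and> (\<forall>u\<in>V. \<forall>v\<in>V. (adjG E src tgt)\<^sup>*\<^sup>* u v)"

definition separating_set :: "'v set \<Rightarrow> 'e set \<Rightarrow> ('e \<Rightarrow> 'v) \<Rightarrow> ('e \<Rightarrow> 'v) \<Rightarrow> 'v set \<Rightarrow> bool" where
  "separating_set V E src tgt S \<longleftrightarrow> S \<subseteq> V \<and>
     (\<exists>a\<in>V - S. \<exists>b\<in>V - S.
        \<not> (\<lambda>x y. x \<notin> S \<and> y \<notin> S \<and> adjG E src tgt x y)\<^sup>*\<^sup>* a b)"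

definition proper_crossing :: "(real \<Rightarrow> complex) \<Rightarrow> (real \<Rightarrow> complex) \<Rightarrow> complex \<Rightarrow> bool" where
  "proper_crossing g1 g2 p \<longleftrightarrow>
     (\<exists>U h k. open U \<and> p \<in> U \<and> homeomorphism U (ball 0 1) h k \<and> h p = 0 \<and>
        h ` (path_image g1 \<inter> U) = ball 0 1 \<inter> \<real> \<and>
        h ` (path_image g2 \<inter> U) = ball 0 1 \<inter> {z. Re z = 0})"

definition crossings_of :: "'v set \<Rightarrow> 'e set \<Rightarrow> ('v \<Rightarrow> complex) \<Rightarrow> ('e \<Rightarrow> real \<Rightarrow> complex) \<Rightarrow> 'e \<Rightarrow> complex set" where
  "crossings_of V E pos crv e =
     {p. \<exists>f\<in>E. f \<noteq> e \<and> p \<in> path_image (crv e) \<inter> path_image (crv f) - pos ` V}"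

definition all_crossings :: "'v set \<Rightarrow> 'e set \<Rightarrow> ('v \<Rightarrow> complex) \<Rightarrow> ('e \<Rightarrow> real \<Rightarrow> complex) \<Rightarrow> complex set" where
  "all_crossings V E pos crv = (\<Union>e\<in>E. crossings_of V E pos crv e)"

definition one_plane :: "'v set \<Rightarrow> 'e set \<Rightarrow> ('e \<Rightarrow> 'v) \<Rightarrow> ('e \<Rightarrow> 'v) \<Rightarrow> ('v \<Rightarrow> complex) \<Rightarrow> ('e \<Rightarrow> real \<Rightarrow> complex) \<Rightarrow> bool" where
  "one_plane V E src tgt pos crv \<longleftrightarrow>
     finite V \<and> finite E \<and>
     (\<forall>e\<in>E. src e \<in> V \<and> tgt e \<in> V \<and> src e \<noteq> tgt e) \<and>
     inj_on pos V \<and>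
     (\<forall>e\<in>E. arc (crv e) \<and> pathstart (crv e) = pos (src e) \<and> pathfinish (crv e) = pos (tgt e) \<and>
        path_image (crv e) \<inter> pos ` V = {pos (src e), pos (tgt e)}) \<and>
     (\<forall>e\<in>E. \<forall>f\<in>E. e \<noteq> f \<longrightarrow>
        (\<forall>p\<in>path_image (crv e) \<inter> path_image (crv f) - pos ` V. proper_crossing (crv e) (crv f) p) \<and>
        (\<forall>p\<in>path_image (crv e) \<inter> path_image (crv f) - pos ` V.
           \<forall>q\<in>path_image (crv e) \<inter> path_image (crv f) - pos ` V. p = q) \<and>
        ({src e, tgt e} \<inter> {src f, tgt f} \<noteq> {} \<longrightarrow>
           path_image (crv e) \<inter> path_image (crv f) - pos ` V = {})) \<and>
     (\<forall>e1\<in>E. \<forall>e2\<in>E. \<forall>e3\<in>E. e1 \<noteq> e2 \<and> e1 \<noteq> e3 \<and> e2 \<noteq> e3 \<longrightarrow>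
        path_image (crv e1) \<inter> path_image (crv e2) \<inter> path_image (crv e3) \<subseteq> pos ` V) \<and>
     (\<forall>e\<in>E. \<forall>p\<in>crossings_of V E pos crv e. \<forall>q\<in>crossings_of V E pos crv e. p = q)"

definition no_x_crossings :: "'v set \<Rightarrow> 'e set \<Rightarrow> ('e \<Rightarrow> 'v) \<Rightarrow> ('e \<Rightarrow> 'v) \<Rightarrow> ('v \<Rightarrow> complex) \<Rightarrow> ('e \<Rightarrow> real \<Rightarrow> complex) \<Rightarrow> bool" where
  "no_x_crossings V E src tgt pos crv \<longleftrightarrow>
     (\<forall>e\<in>E. \<forall>f\<in>E. \<forall>p. e \<noteq> f \<and> p \<in> path_image (crv e) \<inter> path_image (crv f) - pos ` V \<longrightarrow>
        (\<exists>a\<in>{src e, tgt e}. \<exists>b\<in>{src f, tgt f}. adjG E src tgt a b))"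

definition faces :: "'v set \<Rightarrow> 'e set \<Rightarrow> ('v \<Rightarrow> complex) \<Rightarrow> ('e \<Rightarrow> real \<Rightarrow> complex) \<Rightarrow> complex set set" where
  "faces V E pos crv = components (- (pos ` V \<union> (\<Union>e\<in>E. path_image (crv e))))"

text \<open>The part of edge e between its endpoint a and the point p on it
  (the G^x edge (a,p) if p is the crossing on e).\<close>
definition edge_half :: "('e \<Rightarrow> 'v) \<Rightarrow> ('e \<Rightarrow> real \<Rightarrow> complex) \<Rightarrow> 'e \<Rightarrow> 'v \<Rightarrow> complex \<Rightarrow> complex set" where
  "edge_half src crv e a p =
     {crv e s | s. 0 \<le> s \<and> s \<le> 1 \<and>
        (\<exists>t. 0 \<le> t \<and> t \<le> 1 \<and> crv e t = p \<and> (if a = src e then s \<le> t else t \<le> s))}"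

definition kite_edge :: "'v set \<Rightarrow> 'e set \<Rightarrow> ('e \<Rightarrow> 'v) \<Rightarrow> ('e \<Rightarrow> 'v) \<Rightarrow> ('v \<Rightarrow> complex) \<Rightarrow> ('e \<Rightarrow> real \<Rightarrow> complex)
     \<Rightarrow> 'e \<Rightarrow> 'e \<Rightarrow> complex \<Rightarrow> 'v \<Rightarrow> 'v \<Rightarrow> 'e \<Rightarrow> bool" where
  "kite_edge V E src tgt pos crv e f p a b g \<longleftrightarrow>
     g \<in> E \<and> {src g, tgt g} = {a, b} \<and> crossings_of V E pos crv g = {} \<and>
     (\<exists>F\<in>faces V E pos crv.
        frontier F = path_image (crv g) \<union> edge_half src crv e a p \<union> edge_half src crv f b p)"

definition kite_assumption :: "'v set \<Rightarrow> 'e set \<Rightarrow> ('e \<Rightarrow> 'v) \<Rightarrow> ('e \<Rightarrow> 'v) \<Rightarrow> ('v \<Rightarrow> complex) \<Rightarrow> ('e \<Rightarrow> real \<Rightarrow> complex) \<Rightarrow> bool" where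
  "kite_assumption V E src tgt pos crv \<longleftrightarrow>
     (\<forall>e\<in>E. \<forall>f\<in>E. \<forall>p a b. e \<noteq> f \<and> p \<in> path_image (crv e) \<inter> path_image (crv f) - pos ` V \<and>
        a \<in> {src e, tgt e} \<and> b \<in> {src f, tgt f} \<and> adjG E src tgt a b \<longrightarrow>
        (\<exists>g. kite_edge V E src tgt pos crv e f p a b g))"

datatype 'v lvert = GV 'v | CV complex | FV "complex set"

definition lam_verts :: "'v set \<Rightarrow> 'e set \<Rightarrow> ('v \<Rightarrow> complex) \<Rightarrow> ('e \<Rightarrow> real \<Rightarrow> complex) \<Rightarrow> 'v lvert set" where
  "lam_verts V E pos crv = GV ` V \<union> CV ` all_crossings V E pos crv \<union> FV ` faces V E pos crv"

fun lam_adj0 :: "'v set \<Rightarrow> 'e set \<Rightarrow> ('e \<Rightarrow> 'v) \<Rightarrow> ('e \<Rightarrow> 'v) \<Rightarrow> ('v \<Rightarrow> complex) \<Rightarrow> ('e \<Rightarrow> real \<Rightarrow> complex)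
     \<Rightarrow> 'v lvert \<Rightarrow> 'v lvert \<Rightarrow> bool" where
  "lam_adj0 V E src tgt pos crv (GV u) (GV v) =
     (\<exists>e\<in>E. crossings_of V E pos crv e = {} \<and> {src e, tgt e} = {u, v})"
| "lam_adj0 V E src tgt pos crv (GV u) (CV p) =
     (\<exists>e\<in>E. u \<in> {src e, tgt e} \<and> p \<in> crossings_of V E pos crv e)"
| "lam_adj0 V E src tgt pos crv (GV u) (FV F) =
     (u \<in> V \<and> F \<in> faces V E pos crv \<and> pos u \<in> frontier F)"
| "lam_adj0 V E src tgt pos crv (CV p) (FV F) =
     (p \<in> all_crossings V E pos crv \<and> F \<in> faces V E pos crv \<and> p \<in> frontier F)"
| "lam_adj0 V E src tgt pos crv _ _ = False"

text \<open>Adjacency in the radial planarization Lambda(G) (parallel edges are irrelevant here).\<close>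
definition lam_adj :: "'v set \<Rightarrow> 'e set \<Rightarrow> ('e \<Rightarrow> 'v) \<Rightarrow> ('e \<Rightarrow> 'v) \<Rightarrow> ('v \<Rightarrow> complex) \<Rightarrow> ('e \<Rightarrow> real \<Rightarrow> complex)
     \<Rightarrow> 'v lvert \<Rightarrow> 'v lvert \<Rightarrow> bool" where
  "lam_adj V E src tgt pos crv x y \<longleftrightarrow>
     lam_adj0 V E src tgt pos crv x y \<or> lam_adj0 V E src tgt pos crv y x"

definition co_separating_triple :: "'v set \<Rightarrow> 'e set \<Rightarrow> ('e \<Rightarrow> 'v) \<Rightarrow> ('e \<Rightarrow> 'v) \<Rightarrow> ('v \<Rightarrow> complex) \<Rightarrow> ('e \<Rightarrow> real \<Rightarrow> complex)
     \<Rightarrow> 'v lvert set \<Rightarrow> 'v lvert set \<Rightarrow> 'v lvert set \<Rightarrow> bool" where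
  "co_separating_triple V E src tgt pos crv A X B \<longleftrightarrow>
     A \<union> X \<union> B = lam_verts V E pos crv \<and> A \<inter> X = {} \<and> A \<inter> B = {} \<and> X \<inter> B = {} \<and>
     (\<exists>v\<in>V. GV v \<in> A) \<and> (\<exists>v\<in>V. GV v \<in> X) \<and> (\<exists>v\<in>V. GV v \<in> B) \<and>
     (\<forall>a\<in>A. \<forall>b\<in>B. \<not> lam_adj V E src tgt pos crv a b \<and>
        (\<forall>u v. a = GV u \<and> b = GV v \<longrightarrow> \<not> adjG E src tgt u v))"

definition induced_diam_le :: "'v set \<Rightarrow> 'e set \<Rightarrow> ('e \<Rightarrow> 'v) \<Rightarrow> ('e \<Rightarrow> 'v) \<Rightarrow> ('v \<Rightarrow> complex) \<Rightarrow> ('e \<Rightarrow> real \<Rightarrow> complex)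
     \<Rightarrow> 'v lvert set \<Rightarrow> nat \<Rightarrow> bool" where
  "induced_diam_le V E src tgt pos crv X d \<longleftrightarrow>
     (\<forall>x\<in>X. \<forall>y\<in>X. \<exists>ws. ws \<noteq> [] \<and> hd ws = x \<and> last ws = y \<and> set ws \<subseteq> X \<and>
        length ws \<le> d + 1 \<and>
        (\<forall>i. Suc i < length ws \<longrightarrow> lam_adj V E src tgt pos crv (ws ! i) (ws ! Suc i)))"

end

theory Submission
  imports Defs
begin

text \<open>Let \<open>S\<close> be a minimum separating set, \<open>U\<close> a component of \<open>G - S\<close> and \<open>W\<close> the remaining
  vertices. The drawing is the union of two compact connected sets: \<open>\<beta>\<close>, consisting of \<open>W \<union> S\<close>
  and the edges with an end in \<open>W\<close>, and \<open>\<alpha>\<close>, consisting of \<open>U \<union> S\<close> and all other edges. They meet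
  only in \<open>S\<close> and in crossings, each of which has an end in \<open>S\<close> because \<open>\<times>\<close>-crossings are
  excluded. Take \<open>X\<close> to be \<open>\<alpha> \<inter> \<beta>\<close> together with the faces whose boundary lies neither in \<open>\<alpha>\<close>
  nor in \<open>\<beta>\<close>. It is connected in the radial planarization by unicoherence of the plane, applied to
  the points nearer to \<open>\<alpha>\<close> and the points nearer to \<open>\<beta>\<close>. Finally, faces are pairwise nonadjacent
  and every other element of \<open>X\<close> is in or next to \<open>S\<close>, which bounds the length of shortest
  paths.\<close>

subsection \<open>Faces of plane drawings\<close>

text \<open>If an interior point \<open>\<gamma> \<tau>\<close> were off the frontier, so would be a
  whole interval of parameters around \<open>\<tau>\<close>. Each of the two remaining pieces of the
  arc meets what it is added to in a single point, so by Janiszewski's theorem adding both to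
  \<open>D\<close> does not separate \<open>\<gamma> \<tau>\<close> from a point of
  \<open>F\<close>. A connected set joining the two then leaves \<open>F\<close> without meeting its
  frontier, which is absurd.\<close>

lemma face_frontier_contains_arc:
  fixes \<gamma> :: "real \<Rightarrow> complex"
  assumes D: "closed D" and \<gamma>: "arc \<gamma>" and ends: "pathstart \<gamma> \<in> D" "pathfinish \<gamma> \<in> D"
    and disj: "\<gamma> ` {0<..<1} \<inter> D = {}"
    and F: "F \<in> components (- (D \<union> path_image \<gamma>))"
    and meet: "frontier F \<inter> \<gamma> ` {0<..<1} \<noteq> {}"
  shows "path_image \<gamma> \<subseteq> frontier F"
proof -
  have inj: "inj_on \<gamma> {0..1}" and cont: "continuous_on {0..1} \<gamma>"
    using \<gamma> by (auto simp: arc_def path_def)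
  have clD: "closed (D \<union> path_image \<gamma>)"
    using D \<gamma> by (simp add: closed_Un closed_arc_image)
  have frD: "frontier F \<subseteq> D \<union> path_image \<gamma>"
    using frontier_of_components_closed_complement clD F by blast
  have Fsub: "F \<subseteq> - (D \<union> path_image \<gamma>)" "F \<noteq> {}" "connected F"
    using F in_components_subset in_components_nonempty in_components_connected by blast+
  then obtain y where y: "y \<in> F" by blast
  obtain z where z: "z \<in> frontier F" "z \<in> \<gamma> ` {0<..<1}" using meet by blast
  have open_part: "\<gamma> ` {0<..<1} \<subseteq> frontier F"
  proof (rule ccontr)
    assume "\<not> ?thesis"
    then obtain x where "x \<in> \<gamma> ` {0<..<1}" "x \<notin> frontier F" by blast
    then obtain \<tau> where \<tau>: "0 < \<tau>" "\<tau> < 1" "\<gamma> \<tau> \<notin> frontier F" by auto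
    have "continuous_on {0<..<1} \<gamma>"
      using cont by (rule continuous_on_subset) auto
    then have "open ({0<..<1} \<inter> \<gamma> -` (- frontier F))"
      by (intro continuous_open_preimage) (auto simp: open_Compl)
    moreover have "\<tau> \<in> {0<..<1} \<inter> \<gamma> -` (- frontier F)" using \<tau> by auto
    ultimately obtain d where d: "d > 0" "cball \<tau> d \<subseteq> {0<..<1} \<inter> \<gamma> -` (- frontier F)"
      by (meson open_contains_cball)
    define s t where "s = \<tau> - d" and "t = \<tau> + d"
    have st: "s < \<tau>" "\<tau> < t" using d by (auto simp: s_def t_def)
    have "s \<in> cball \<tau> d" "t \<in> cball \<tau> d" using d by (auto simp: s_def t_def dist_real_def)
    then have st01: "0 < s" "t < 1" using d by auto
    have avoid: "\<gamma> u \<notin> frontier F" if "s \<le> u" "u \<le> t" for u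
      using d that by (auto simp: s_def t_def subset_iff dist_real_def)
    define \<gamma>1 \<gamma>2 where "\<gamma>1 = \<gamma> ` {0..s}" and "\<gamma>2 = \<gamma> ` {t..1}"
    have arcs: "arc (subpath 0 s \<gamma>)" "arc (subpath t 1 \<gamma>)"
      using \<gamma> st st01 by (auto intro!: arc_subpath_arc)
    have im: "path_image (subpath 0 s \<gamma>) = \<gamma>1" "path_image (subpath t 1 \<gamma>) = \<gamma>2"
      using st st01 by (auto simp: path_image_subpath \<gamma>1_def \<gamma>2_def)
    have con: "connected (- \<gamma>1)" "connected (- \<gamma>2)" and cpt: "compact \<gamma>1" "compact \<gamma>2"
      using connected_arc_complement [OF arcs(1)] connected_arc_complement [OF arcs(2)]
        compact_arc_image [OF arcs(1)] compact_arc_image [OF arcs(2)] im by auto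
    let ?q = "\<gamma> \<tau>"
    have offD: "\<gamma> u \<notin> D" if "0 < u" "u < 1" for u
      using disj that by (metis disjoint_iff greaterThanLessThan_iff imageI)
    then have q: "?q \<notin> D" using \<tau> by blast
    have qn: "?q \<notin> \<gamma>1" "?q \<notin> \<gamma>2"
      using inj_onD [OF inj] st st01 by (force simp: \<gamma>1_def \<gamma>2_def)+
    have "\<gamma>1 \<subseteq> path_image \<gamma>" "\<gamma>2 \<subseteq> path_image \<gamma>"
      unfolding \<gamma>1_def \<gamma>2_def path_image_def using st st01 by (intro image_mono; simp)+
    then have yn: "y \<notin> D" "y \<notin> \<gamma>1" "y \<notin> \<gamma>2"
      using y Fsub(1) by blast+
    \<comment> \<open>\<open>F\<close> together with its frontier point \<open>z\<close> and the
      open arc is connected and misses \<open>D\<close>.\<close>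
    have 0: "connected_component (- D) y ?q"
    proof -
      have "connected (insert z F)"
      proof (rule connected_intermediate_closure [OF Fsub(3)])
        show "insert z F \<subseteq> closure F"
          using z(1) closure_subset unfolding frontier_def by fast
      qed blast
      moreover have "connected (\<gamma> ` {0<..<1})"
        by (intro connected_continuous_image continuous_on_subset [OF cont]) auto
      ultimately have "connected (insert z F \<union> \<gamma> ` {0<..<1})"
        using z by (intro connected_Un) auto
      moreover have "insert z F \<union> \<gamma> ` {0<..<1} \<subseteq> - D" using Fsub disj z by auto
      moreover have "?q \<in> \<gamma> ` {0<..<1}" using \<tau> by auto
      ultimately show ?thesis using y unfolding connected_component_def by blast
    qed
    have 1: "connected_component (- (\<gamma>1 \<union> D)) y ?q"
    proof (rule Janiszewski)
      have "\<gamma>1 \<inter> D = {\<gamma> 0}"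
      proof -
        have "\<gamma> u \<notin> D" if "0 < u" "u \<le> s" for u using offD that st st01 by simp
        then show ?thesis using ends st st01 unfolding \<gamma>1_def pathstart_def
          by (force simp: less_le)
      qed
      then show "connected (\<gamma>1 \<inter> D)" by simp
      show "connected_component (- \<gamma>1) y ?q"
        using con yn qn unfolding connected_component_def by blast
    qed (use 0 cpt D in auto)
    have 2: "connected_component (- (\<gamma>2 \<union> (\<gamma>1 \<union> D))) y ?q"
    proof (rule Janiszewski)
      have "\<gamma>2 \<inter> (\<gamma>1 \<union> D) = {\<gamma> 1}"
      proof -
        have "\<gamma> u \<notin> D" if "t \<le> u" "u < 1" for u using offD that st st01 by simp
        moreover have "\<gamma>2 \<inter> \<gamma>1 = {}"
          using inj_onD [OF inj] st st01 by (force simp: \<gamma>1_def \<gamma>2_def)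
        ultimately show ?thesis using ends st st01 unfolding \<gamma>2_def pathfinish_def
          by (force simp: less_le)
      qed
      then show "connected (\<gamma>2 \<inter> (\<gamma>1 \<union> D))" by simp
      show "connected_component (- \<gamma>2) y ?q"
        using con yn qn unfolding connected_component_def by blast
    qed (use 1 cpt D in \<open>auto simp: compact_imp_closed closed_Un\<close>)
    then obtain T where T: "connected T" "T \<subseteq> - (\<gamma>2 \<union> (\<gamma>1 \<union> D))" "y \<in> T" "?q \<in> T"
      unfolding connected_component_def by blast
    have "?q \<notin> F" using Fsub \<tau> by (auto simp: path_image_def)
    then have "T \<inter> frontier F \<noteq> {}"
      using T y by (intro connected_Int_frontier) auto
    moreover have "frontier F \<subseteq> \<gamma>2 \<union> (\<gamma>1 \<union> D)"
    proof
      fix x assume x: "x \<in> frontier F"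
      then have "x \<in> D \<union> \<gamma> ` {0..1}" using frD by (auto simp: path_image_def)
      then consider "x \<in> D" | u where "0 \<le> u" "u \<le> 1" "x = \<gamma> u"
        by auto
      then show "x \<in> \<gamma>2 \<union> (\<gamma>1 \<union> D)"
      proof cases
        case 2
        then have "u \<in> {0..s} \<or> u \<in> {t..1}" using avoid [of u] x by force
        then show ?thesis using 2 unfolding \<gamma>1_def \<gamma>2_def by blast
      qed auto
    qed
    ultimately show False using T by blast
  qed
  have "path_image \<gamma> = \<gamma> ` closure {0<..<1}"
    by (simp add: path_image_def closure_greaterThanLessThan)
  also have "\<dots> \<subseteq> closure (\<gamma> ` {0<..<1})"
    by (rule continuous_image_closure_subset [of "{0..1}"])
      (auto simp: cont closure_greaterThanLessThan)
  also have "\<dots> \<subseteq> frontier F"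
    using open_part by (rule closure_minimal) simp
  finally show ?thesis .
qed

text \<open>Near \<open>p\<close> the drawing consists of \<open>p\<close> and subarcs issuing from
  \<open>p\<close>. A small ball meeting \<open>F\<close> also meets the frontier of
  \<open>F\<close>, as otherwise \<open>F\<close> would contain \<open>p\<close>; the previous
  lemma, applied to the subarc that is hit, puts \<open>p\<close> on the frontier. Points of
  \<open>M\<close> may lie inside edges, so crossings can be included without cutting the
  curves.\<close>

lemma face_near_vertex:
  fixes c :: "'e \<Rightarrow> real \<Rightarrow> complex"
  assumes fin: "finite M" "finite E"
    and arcs: "\<And>e. e \<in> E \<Longrightarrow> arc (c e)"
    and ends: "\<And>e. e \<in> E \<Longrightarrow> pathstart (c e) \<in> M \<and> pathfinish (c e) \<in> M"
    and meet: "\<And>e f. e \<in> E \<Longrightarrow> f \<in> E \<Longrightarrow> e \<noteq> f \<Longrightarrow> path_image (c e) \<inter> path_image (c f) \<subseteq> M"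
    and D: "D = M \<union> (\<Union>e\<in>E. path_image (c e))"
    and p: "p \<in> M"
  shows "\<exists>r>0. \<forall>F\<in>components (- D). F \<inter> ball p r \<noteq> {} \<longrightarrow> p \<in> frontier F"
proof -
  \<comment> \<open>Open subarcs issuing from \<open>p\<close> and free of points of
    \<open>M\<close>. \<open>open_segment\<close> covers both directions along the edge, since
    \<open>t\<close> may be below or above \<open>s\<close>.\<close>
  define pieces where "pieces = {(e, s, t). e \<in> E \<and> s \<in> {0..1} \<and> t \<in> {0..1} \<and> s \<noteq> t \<and>
     c e s = p \<and> c e ` open_segment s t \<inter> M = {}}"
  have inj: "inj_on (c e) {0..1}" and cont: "continuous_on {0..1} (c e)" if "e \<in> E" for e
    using arcs [OF that] by (auto simp: arc_def path_def)
  have clD: "closed D"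
    unfolding D using fin arcs by (intro closed_Un closed_UN ballI finite_imp_closed closed_arc_image)
  have piece: "p \<in> frontier F"
    if F: "F \<in> components (- D)" and est: "(e, s, t) \<in> pieces"
      and z: "frontier F \<inter> c e ` open_segment s t \<noteq> {}" for F e s t
  proof -
    have e: "e \<in> E" and s: "s \<in> {0..1}" "t \<in> {0..1}" "s \<noteq> t" and ps: "c e s = p"
      and miss: "c e ` open_segment s t \<inter> M = {}"
      using est by (auto simp: pieces_def)
    \<comment> \<open>All of the drawing except the open subarc, so that the arc lemma applies to
      the subarc with both ends in \<open>D'\<close>.\<close>
    define D' where "D' = M \<union> (\<Union>f\<in>E - {e}. path_image (c f)) \<union> c e ` ({0..1} - open_segment s t)"
    let ?g = "subpath s t (c e)"
    have sub01: "open_segment s t \<subseteq> {0..1}" "closed_segment s t \<subseteq> {0..1}"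
      using s by (auto simp: open_segment_eq_real_ivl closed_segment_eq_real_ivl split: if_splits)
    have g: "arc ?g" using arcs [OF e] s by (intro arc_subpath_arc) auto
    have img: "path_image ?g = c e ` closed_segment s t" by (rule path_image_subpath_gen)
    have ivl: "(\<lambda>x. (t - s) * x + s) ` {0<..<1} = open_segment s t"
      using s(3) by (auto simp: open_segment_image_interval algebra_simps)
    then have gim: "?g ` {0<..<1} = c e ` open_segment s t"
      unfolding subpath_def by (metis (no_types, lifting) image_cong image_image)
    have "open (open_segment s t)" by (simp add: open_segment_eq_real_ivl)
    then have "compact ({0..1} - open_segment s t)" by (intro compact_diff) auto
    then have "compact (c e ` ({0..1} - open_segment s t))"
      by (intro compact_continuous_image continuous_on_subset [OF cont [OF e]]) auto
    then have clD': "closed D'"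
      unfolding D'_def using fin arcs compact_imp_closed
      by (intro closed_Un closed_UN ballI) (auto intro: finite_imp_closed closed_arc_image)
    have endpts: "s \<notin> open_segment s t" "t \<notin> open_segment s t" by (auto simp: open_segment_def)
    have "path_image (c e) = c e ` ({0..1} - open_segment s t) \<union> c e ` closed_segment s t"
      using sub01 unfolding path_image_def by (auto simp: open_segment_def)
    then have DD': "D = D' \<union> path_image ?g"
      using e unfolding D D'_def img by blast
    have disj: "?g ` {0<..<1} \<inter> D' = {}"
    proof -
      have "c e ` open_segment s t \<inter> c e ` ({0..1} - open_segment s t) = {}"
        using inj_onD [OF inj [OF e]] sub01 by blast
      moreover have "c e ` open_segment s t \<subseteq> path_image (c e)"
        using sub01 by (auto simp: path_image_def)
      ultimately show ?thesis
        using meet [OF e] miss unfolding gim D'_def by blast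
    qed
    have "path_image ?g \<subseteq> frontier F"
      by (rule face_frontier_contains_arc [OF clD' g _ _ disj])
        (use F z s endpts in \<open>auto simp: DD' gim D'_def\<close>)
    moreover have "p \<in> path_image ?g" using ps img by auto
    ultimately show ?thesis by blast
  qed
  \<comment> \<open>\<open>R\<close> is the part of the edge away from \<open>p\<close>; being
    closed and without \<open>p\<close>, it is missed by some ball around \<open>p\<close>.\<close>
  have "\<exists>R. closed R \<and> p \<notin> R \<and>
      path_image (c e) \<subseteq> insert p (R \<union> (\<Union>(f, s, t)\<in>pieces. c f ` open_segment s t))" if e: "e \<in> E" for e
  proof (cases "p \<in> path_image (c e)")
    case False
    then show ?thesis using e arcs by (intro exI [of _ "path_image (c e)"]) (auto intro: closed_arc_image)
  next
    case True
    then obtain s where s: "s \<in> {0..1}" "c e s = p" by (auto simp: path_image_def)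
    define K where "K = {t \<in> {0..1}. c e t \<in> M}"
    have "finite K"
      using finite_vimage_IntI [OF fin(1) inj [OF e]] by (simp add: K_def vimage_def Int_def conj_commute)
    then obtain d where d: "d > 0" "\<And>t. t \<in> K \<Longrightarrow> t \<noteq> s \<Longrightarrow> d \<le> dist s t"
      using finite_set_avoid by metis
    have miss: "c e u \<notin> M" if "u \<in> {0..1}" "u \<noteq> s" "dist s u < d" for u
      using d(2) [of u] that by (auto simp: K_def)
    let ?R = "c e ` ({0..1} - ball s d)"
    have "compact ?R"
      by (intro compact_continuous_image continuous_on_subset [OF cont [OF e]] compact_diff) auto
    moreover have "p \<notin> ?R" using inj_onD [OF inj [OF e]] s d(1) by force
    moreover have "c e u \<in> (\<Union>(f, s, t)\<in>pieces. c f ` open_segment s t)"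
      if u: "u \<in> {0..1}" "u \<noteq> s" "dist s u < d" for u
    proof -
      \<comment> \<open>The ends of an edge lie in \<open>M\<close>, so a parameter this close to
        \<open>s\<close> but different from it is neither 0 nor 1. This leaves room for
        \<open>t\<close> beyond \<open>u\<close> after truncation to the unit interval.\<close>
      have "0 \<in> K" "1 \<in> K" using ends [OF e] by (auto simp: K_def pathstart_def pathfinish_def)
      then have u01: "0 < u" "u < 1"
        using u miss [OF u] unfolding K_def by (auto simp: less_le)
      have "\<exists>t\<in>{0..1}. u \<in> open_segment s t \<and> open_segment s t \<subseteq> ball s d"
      proof (cases "s < u")
        case True
        then show ?thesis using u u01 s
          by (intro bexI [of _ "min 1 (s + d)"]) (auto simp: open_segment_eq_real_ivl dist_real_def)
      next
        case False
        then show ?thesis using u u01 s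
          by (intro bexI [of _ "max 0 (s - d)"]) (auto simp: open_segment_eq_real_ivl dist_real_def)
      qed
      then obtain t where t: "t \<in> {0..1}" "u \<in> open_segment s t" "open_segment s t \<subseteq> ball s d" by blast
      have "open_segment s t \<subseteq> {0..1} - {s}"
        using s t by (auto simp: open_segment_eq_real_ivl split: if_splits)
      then have "(e, s, t) \<in> pieces"
        using e s t miss unfolding pieces_def by (auto simp: subset_iff)
      then show ?thesis using t by blast
    qed
    then have "path_image (c e) \<subseteq> insert p (?R \<union> (\<Union>(f, s, t)\<in>pieces. c f ` open_segment s t))"
      using s unfolding path_image_def by (intro image_subsetI) (metis (no_types, lifting) DiffI UnI1 UnI2 imageI insertCI mem_ball)
    ultimately show ?thesis by (meson compact_imp_closed)
  qed
  then obtain R where R: "\<And>e. e \<in> E \<Longrightarrow> closed (R e)" "\<And>e. e \<in> E \<Longrightarrow> p \<notin> R e"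
    "\<And>e. e \<in> E \<Longrightarrow> path_image (c e) \<subseteq> insert p (R e \<union> (\<Union>(f, s, t)\<in>pieces. c f ` open_segment s t))"
    by metis
  define RR where "RR = (M - {p}) \<union> (\<Union>e\<in>E. R e)"
  have "closed RR" "p \<notin> RR"
    using R fin unfolding RR_def by (auto intro!: closed_Un closed_UN intro: finite_imp_closed)
  then obtain r where r: "r > 0" "ball p r \<subseteq> - RR"
    by (meson ComplI open_Compl open_contains_ball)
  have "p \<in> frontier F" if F: "F \<in> components (- D)" and m: "F \<inter> ball p r \<noteq> {}" for F
  proof (rule ccontr)
    assume np: "p \<notin> frontier F"
    have "frontier F \<subseteq> D" using F clD frontier_of_components_closed_complement by blast
    moreover have "D \<subseteq> insert p (RR \<union> (\<Union>(f, s, t)\<in>pieces. c f ` open_segment s t))"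
      unfolding D RR_def using R(3) by blast
    moreover have "frontier F \<inter> (\<Union>(f, s, t)\<in>pieces. c f ` open_segment s t) = {}"
      using piece [OF F] np by blast
    ultimately have "frontier F \<inter> ball p r = {}" using r np by blast
    then have "ball p r \<subseteq> F"
      using connected_Int_frontier [of "ball p r" F] m by (auto simp: Int_commute)
    then have "p \<in> F" using r(1) by auto
    then show False using p in_components_subset [OF F] unfolding D by blast
  qed
  then show ?thesis using r by blast
qed

text \<open>On the segment from \<open>x\<close> to a nearest point \<open>z\<close> of
  \<open>\<alpha>\<close>, the distance to \<open>\<alpha>\<close> falls by the length travelled and
  the distance to \<open>\<beta>\<close> falls no faster, so the segment stays on the nearer side.
  It enters no removed face, because \<open>x\<close> would already lie in that face. Thus every
  point is joined to the connected set \<open>\<alpha>\<close>.\<close>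

lemma nearer_part_connected:
  fixes \<alpha> \<beta> :: "'a::euclidean_space set"
  assumes cl: "closed \<alpha>" "closed \<beta>" and ne: "\<alpha> \<noteq> {}" "\<beta> \<noteq> {}" and con: "connected \<alpha>"
    and sub: "\<F> \<subseteq> components (- (\<alpha> \<union> \<beta>))"
  shows "connected ({x. infdist x \<alpha> \<le> infdist x \<beta>} - \<Union>\<F>)" (is "connected ?P")
proof -
  have \<alpha>P: "\<alpha> \<subseteq> ?P" using sub in_components_subset by (fastforce simp: infdist_nonneg)
  have "\<exists>T. connected T \<and> T \<subseteq> ?P \<and> x \<in> T \<and> \<alpha> \<subseteq> T" if x: "x \<in> ?P" for x
  proof -
    obtain z where z: "z \<in> \<alpha>" "infdist x \<alpha> = dist x z"
      using infdist_attains_inf [OF cl(1) ne(1)] by blast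
    have dist_split: "dist x z = dist x y + dist y z" if "y \<in> closed_segment x z" for y
      using that between between_mem_segment by blast
    have "closed_segment x z \<subseteq> ?P"
    proof
      fix y assume y: "y \<in> closed_segment x z"
      have "infdist y \<alpha> \<le> dist y z" using z by (simp add: infdist_le)
      moreover have "infdist x \<beta> \<le> infdist y \<beta> + dist x y" by (rule infdist_triangle)
      ultimately have 1: "infdist y \<alpha> \<le> infdist y \<beta>" using x z dist_split [OF y] by auto
      have 2: "y \<notin> F" if F: "F \<in> \<F>" for F
      proof
        assume yF: "y \<in> F"
        have comp: "F \<in> components (- (\<alpha> \<union> \<beta>))" using F sub by blast
        then have "y \<noteq> z" using yF z in_components_subset by blast
        \<comment> \<open>These points are closer to \<open>x\<close> than \<open>\<alpha>\<close>
          is, and \<open>\<beta>\<close> is at least as far from \<open>x\<close> as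
          \<open>\<alpha>\<close>.\<close>
        have "closed_segment x y \<subseteq> - (\<alpha> \<union> \<beta>)"
        proof
          fix w assume w: "w \<in> closed_segment x y"
          then have "dist x w \<le> dist x y" by (metis dist_in_closed_segment dist_commute)
          also have "\<dots> < dist x z" using dist_split [OF y] \<open>y \<noteq> z\<close> by simp
          finally have lt: "dist x w < infdist x \<alpha>" using z by simp
          then have "w \<notin> \<alpha>" using infdist_le [of w \<alpha> x] by auto
          moreover have "w \<notin> \<beta>" using infdist_le [of w \<beta> x] lt x by auto
          ultimately show "w \<in> - (\<alpha> \<union> \<beta>)" by simp
        qed
        then have "closed_segment x y \<subseteq> F"
          using components_maximal [OF comp, of "closed_segment x y"] yF by auto
        then show False using x F by auto
      qed
      show "y \<in> ?P" using 1 2 by auto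
    qed
    moreover have "connected (closed_segment x z \<union> \<alpha>)"
      using con z by (intro connected_Un) auto
    ultimately show ?thesis using \<alpha>P
      by (intro exI [of _ "closed_segment x z \<union> \<alpha>"]) auto
  qed
  then obtain T where T: "\<And>x. x \<in> ?P \<Longrightarrow> connected (T x) \<and> T x \<subseteq> ?P \<and> x \<in> T x \<and> \<alpha> \<subseteq> T x"
    by metis
  have "?P = (\<Union>x\<in>?P. T x)" using T by blast
  moreover have "connected (\<Union>x\<in>?P. T x)"
  proof (rule connected_Union)
    show "\<Inter> (T ` ?P) \<noteq> {}" using T ne(1) by blast
  qed (use T in auto)
  ultimately show ?thesis by simp
qed

text \<open>The segment from \<open>x\<close> to a nearest point of \<open>\<alpha>\<close> must
  leave \<open>F\<close>, and it does so at a point of \<open>\<beta>\<close>.\<close>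

lemma infdist_le_of_frontier_subset:
  fixes \<alpha> \<beta> :: "'a::euclidean_space set"
  assumes cl: "closed \<alpha>" and ne: "\<alpha> \<noteq> {}" and disj: "F \<inter> \<alpha> = {}"
    and x: "x \<in> F" and fr: "frontier F \<subseteq> \<beta>"
  shows "infdist x \<beta> \<le> infdist x \<alpha>"
proof -
  obtain z where z: "z \<in> \<alpha>" "infdist x \<alpha> = dist x z"
    using infdist_attains_inf [OF cl ne] by blast
  have "z \<notin> F" using z disj by blast
  then have "closed_segment x z \<inter> frontier F \<noteq> {}"
    using x by (intro connected_Int_frontier) auto
  then obtain w where w: "w \<in> closed_segment x z" "w \<in> \<beta>" using fr by blast
  have "infdist x \<beta> \<le> dist x w" using w by (simp add: infdist_le)
  also have "\<dots> \<le> dist x z" using w by (metis dist_in_closed_segment dist_commute)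
  finally show ?thesis using z by simp
qed

text \<open>Call a face mixed if its frontier lies in neither set, and suppose that no mixed face
  touches both \<open>I\<close> and \<open>J\<close>. The sets \<open>P\<close> and \<open>Q\<close>
  below are closed, connected and cover the space, so \<open>P \<inter> Q\<close> is connected by
  unicoherence. It consists of \<open>I \<union> J\<close> and points of mixed faces; sorting these
  by the part they touch splits it into two relatively open pieces. The hypothesis on balls provides
  openness at \<open>I\<close> and \<open>J\<close>.\<close>

lemma linking_face:
  fixes \<alpha> \<beta> :: "'a::euclidean_space set"
  assumes cl: "closed \<alpha>" "closed \<beta>" and con: "connected \<alpha>" "connected \<beta>"
    and int: "\<alpha> \<inter> \<beta> = I \<union> J" "I \<inter> J = {}" "I \<noteq> {}" "J \<noteq> {}" "finite I" "finite J"
    and near: "\<And>p. p \<in> \<alpha> \<inter> \<beta> \<Longrightarrow>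
      \<exists>r>0. \<forall>F\<in>components (- (\<alpha> \<union> \<beta>)). F \<inter> ball p r \<noteq> {} \<longrightarrow> p \<in> frontier F"
  shows "\<exists>F\<in>components (- (\<alpha> \<union> \<beta>)). \<not> frontier F \<subseteq> \<alpha> \<and> \<not> frontier F \<subseteq> \<beta> \<and>
     frontier F \<inter> I \<noteq> {} \<and> frontier F \<inter> J \<noteq> {}"
proof (rule ccontr)
  assume none: "\<not> ?thesis"
  let ?C = "components (- (\<alpha> \<union> \<beta>))"
  have ne: "\<alpha> \<noteq> {}" "\<beta> \<noteq> {}" using int by blast+
  have opn: "open F" if "F \<in> ?C" for F
    using that cl open_components [of "- (\<alpha> \<union> \<beta>)"] by (auto simp: open_Compl closed_Un)
  have sub: "F \<inter> \<alpha> = {}" "F \<inter> \<beta> = {}" if "F \<in> ?C" for F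
    using in_components_subset [OF that] by auto
  \<comment> \<open>Faces bounded by \<open>\<beta>\<close> are cut out of \<open>P\<close> and
    faces bounded by \<open>\<alpha>\<close> out of \<open>Q\<close>, which keeps both kinds out of
    \<open>P \<inter> Q\<close>. The asymmetric condition makes the two families disjoint, so no
    face is lost from both \<open>P\<close> and \<open>Q\<close>.\<close>
  define \<F> where "\<F> = {F \<in> ?C. frontier F \<subseteq> \<beta> \<and> \<not> frontier F \<subseteq> \<alpha>}"
  define \<G> where "\<G> = {F \<in> ?C. frontier F \<subseteq> \<alpha>}"
  define P where "P = {x. infdist x \<alpha> \<le> infdist x \<beta>} - \<Union>\<F>"
  define Q where "Q = {x. infdist x \<beta> \<le> infdist x \<alpha>} - \<Union>\<G>"
  have "connected P" unfolding P_def
    by (rule nearer_part_connected) (use cl ne con in \<open>auto simp: \<F>_def\<close>)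
  moreover have "connected Q" unfolding Q_def
    by (rule nearer_part_connected) (use cl ne con in \<open>auto simp: \<G>_def Un_commute\<close>)
  moreover have "closed P" "closed Q" unfolding P_def Q_def
    using opn by (auto simp: \<F>_def \<G>_def intro!: closed_Diff closed_Collect_le continuous_intros open_Union)
  moreover have "P \<union> Q = UNIV"
  proof (intro set_eqI iffI)
    fix x :: 'a
    show "x \<in> P \<union> Q"
    proof (cases "\<exists>F\<in>?C. x \<in> F")
      case True
      then obtain F where F: "F \<in> ?C" "x \<in> F" by blast
      have uniq: "F' = F" if "F' \<in> ?C" "x \<in> F'" for F'
        using F that components_eq by blast
      have "F' = F" if "F' \<in> \<F> \<union> \<G>" "x \<in> F'" for F'
        using uniq that unfolding \<F>_def \<G>_def by blast
      then have iffs: "x \<in> \<Union>\<F> \<longleftrightarrow> F \<in> \<F>" "x \<in> \<Union>\<G> \<longleftrightarrow> F \<in> \<G>"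
        using F(2) by blast+
      \<comment> \<open>A face bounded by \<open>\<beta>\<close> consists of points at least as near
        to \<open>\<beta>\<close> as to \<open>\<alpha>\<close>, so \<open>Q\<close> covers what
        \<open>P\<close> loses; the next claim is symmetric.\<close>
      have "infdist x \<beta> \<le> infdist x \<alpha>" if "F \<in> \<F>"
        by (rule infdist_le_of_frontier_subset [of _ F]) (use that F sub cl ne in \<open>simp_all add: \<F>_def\<close>)
      moreover have "infdist x \<alpha> \<le> infdist x \<beta>" if "F \<in> \<G>"
        by (rule infdist_le_of_frontier_subset [of _ F]) (use that F sub cl ne in \<open>simp_all add: \<G>_def\<close>)
      moreover have "F \<notin> \<F> \<or> F \<notin> \<G>" by (simp add: \<F>_def \<G>_def)
      ultimately show ?thesis
        unfolding P_def Q_def Un_iff Diff_iff mem_Collect_eq iffs by linarith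
    next
      case False
      then have "x \<notin> \<Union>\<F>" "x \<notin> \<Union>\<G>" unfolding \<F>_def \<G>_def by blast+
      then show ?thesis unfolding P_def Q_def Un_iff Diff_iff mem_Collect_eq by linarith
    qed
  qed auto
  ultimately have conPQ: "connected (P \<inter> Q)"
    by (intro unicoherentD [OF unicoherent_UNIV]) auto
  \<comment> \<open>The two distances agree on \<open>P \<inter> Q\<close>, and one of them vanishes
    on the drawing.\<close>
  have PQ_D: "P \<inter> Q \<inter> (\<alpha> \<union> \<beta>) = I \<union> J"
  proof -
    have "x \<in> \<alpha> \<longleftrightarrow> infdist x \<alpha> = 0" "x \<in> \<beta> \<longleftrightarrow> infdist x \<beta> = 0" for x
      using cl ne by (auto simp: in_closed_iff_infdist_zero)
    moreover have "x \<notin> \<Union>\<F>" "x \<notin> \<Union>\<G>" if "x \<in> \<alpha> \<union> \<beta>" for x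
      using that sub unfolding \<F>_def \<G>_def by blast+
    ultimately have "x \<in> P \<inter> Q \<inter> (\<alpha> \<union> \<beta>) \<longleftrightarrow> x \<in> \<alpha> \<inter> \<beta>" for x
      unfolding P_def Q_def Int_iff Un_iff Diff_iff mem_Collect_eq
      by (metis infdist_nonneg order_antisym)
    then show ?thesis unfolding int(1) [symmetric] by blast
  qed
  define mid where "mid = {F \<in> ?C. \<not> frontier F \<subseteq> \<alpha> \<and> \<not> frontier F \<subseteq> \<beta>}"
  have PQ_F: "F \<in> mid" if "F \<in> ?C" "x \<in> F" "x \<in> P \<inter> Q" for F x
    using that unfolding mid_def P_def Q_def \<F>_def \<G>_def by blast
  have mid: "frontier F \<inter> I = {} \<or> frontier F \<inter> J = {}" if "F \<in> mid" for F
    using none that by (auto simp: mid_def)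
  have ex: "\<exists>F. F \<in> ?C \<and> x \<in> F" if "x \<notin> \<alpha> \<union> \<beta>" for x
    using that Union_components [of "- (\<alpha> \<union> \<beta>)"] by blast
  \<comment> \<open>Used with \<open>K = I\<close> and with \<open>K = J\<close>: an open set that
    singles out \<open>K\<close> and enters only faces touching \<open>K\<close>.\<close>
  have nbhd: "\<exists>U. open U \<and> U \<inter> (I \<union> J) = K \<and> (\<forall>F\<in>?C. F \<inter> U \<noteq> {} \<longrightarrow> frontier F \<inter> K \<noteq> {})"
    if K: "K \<subseteq> I \<union> J" for K
  proof -
    have "\<forall>p\<in>K. \<exists>r>0. \<forall>F\<in>?C. F \<inter> ball p r \<noteq> {} \<longrightarrow> p \<in> frontier F"
      using near K int(1) by blast
    then obtain r where r: "\<And>p. p \<in> K \<Longrightarrow> r p > 0"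
      "\<And>p F. p \<in> K \<Longrightarrow> F \<in> ?C \<Longrightarrow> F \<inter> ball p (r p) \<noteq> {} \<Longrightarrow> p \<in> frontier F"
      by metis
    let ?U = "(\<Union>p\<in>K. ball p (r p)) - (I \<union> J - K)"
    have "finite (I \<union> J - K)" using int by auto
    then have "open ?U" by (intro open_Diff) (auto intro: finite_imp_closed)
    moreover have "K \<subseteq> (\<Union>p\<in>K. ball p (r p))" using r(1) by auto
    then have "?U \<inter> (I \<union> J) = K" using K by blast
    moreover have "\<forall>F\<in>?C. F \<inter> ?U \<noteq> {} \<longrightarrow> frontier F \<inter> K \<noteq> {}" using r(2) by blast
    ultimately show ?thesis by (intro exI [of _ ?U] conjI)
  qed
  obtain U0 where nI: "open U0" "U0 \<inter> (I \<union> J) = I"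
    "\<And>F. F \<in> ?C \<Longrightarrow> F \<inter> U0 \<noteq> {} \<Longrightarrow> frontier F \<inter> I \<noteq> {}"
    using nbhd [of I] by auto
  obtain W0 where nJ: "open W0" "W0 \<inter> (I \<union> J) = J"
    "\<And>F. F \<in> ?C \<Longrightarrow> F \<inter> W0 \<noteq> {} \<Longrightarrow> frontier F \<inter> J \<noteq> {}"
    using nbhd [of J] by auto
  \<comment> \<open>Mixed faces touching \<open>J\<close> go to \<open>W\<close>, all others to
    \<open>U\<close>, including those that touch neither part.\<close>
  define U where "U = U0 \<union> \<Union>{F \<in> mid. frontier F \<inter> J = {}}"
  define W where "W = W0 \<union> \<Union>{F \<in> mid. frontier F \<inter> J \<noteq> {}}"
  have midC: "F \<in> ?C" if "F \<in> mid" for F using that by (simp add: mid_def)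
  have "open U" "open W"
    unfolding U_def W_def using nI(1) nJ(1) opn midC by (auto intro!: open_Un open_Union)
  moreover have "P \<inter> Q \<subseteq> U \<union> W"
  proof
    fix x assume x: "x \<in> P \<inter> Q"
    show "x \<in> U \<union> W"
    proof (cases "x \<in> \<alpha> \<union> \<beta>")
      case True
      then show ?thesis using x PQ_D nI(2) nJ(2) unfolding U_def W_def by blast
    next
      case False
      then show ?thesis using ex PQ_F x unfolding U_def W_def by blast
    qed
  qed
  moreover have "U \<inter> W \<inter> (P \<inter> Q) = {}"
  proof -
    have False if x: "x \<in> U" "x \<in> W" "x \<in> P \<inter> Q" for x
    proof (cases "x \<in> \<alpha> \<union> \<beta>")
      case True
      then have "x \<in> I \<union> J" using x PQ_D by blast
      moreover have "x \<notin> F" if "F \<in> mid" for F using True sub midC that by blast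
      ultimately show False using x nI(2) nJ(2) int(2) unfolding U_def W_def by blast
    next
      case False
      then obtain F where F: "F \<in> ?C" "x \<in> F" using ex by blast
      then have Fm: "F \<in> mid" using PQ_F x by blast
      have uniq: "F' = F" if "F' \<in> mid" "x \<in> F'" for F'
        using F that components_eq midC by blast
      have "frontier F \<inter> J = {}" using x(1) nI(3) [OF F(1)] mid [OF Fm] F uniq
        unfolding U_def by blast
      moreover have "frontier F \<inter> J \<noteq> {}" using x(2) nJ(3) [OF F(1)] F uniq
        unfolding W_def by blast
      ultimately show False by blast
    qed
    then show ?thesis by blast
  qed
  moreover have "U \<inter> (P \<inter> Q) \<noteq> {}" "W \<inter> (P \<inter> Q) \<noteq> {}"
    using nI(2) nJ(2) int(3,4) PQ_D unfolding U_def W_def by blast+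
  ultimately show False using connectedD [OF conPQ] by blast
qed

subsection \<open>Reachability and short paths\<close>

lemma adjG_sym: "adjG E src tgt u v \<Longrightarrow> adjG E src tgt v u"
  unfolding adjG_def by blast

lemma adjG_mono: "E \<subseteq> E' \<Longrightarrow> adjG E src tgt u v \<Longrightarrow> adjG E' src tgt u v"
  unfolding adjG_def by blast

lemma adjG_rtranclp_mono: "E \<subseteq> E' \<Longrightarrow> (adjG E src tgt)\<^sup>*\<^sup>* u v \<Longrightarrow> (adjG E' src tgt)\<^sup>*\<^sup>* u v"
  by (metis adjG_mono mono_rtranclp)

lemma adjG_rtranclp_sym: "(adjG E src tgt)\<^sup>*\<^sup>* u v \<Longrightarrow> (adjG E src tgt)\<^sup>*\<^sup>* v u"
  by (induction rule: rtranclp_induct) (auto intro: adjG_sym converse_rtranclp_into_rtranclp)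

lemma lam_adj_sym: "lam_adj V E src tgt pos crv x y \<Longrightarrow> lam_adj V E src tgt pos crv y x"
  unfolding lam_adj_def by blast

lemma connected_drawing:
  assumes edges: "\<And>e. e \<in> E \<Longrightarrow> path (c e) \<and> pathstart (c e) = pos (src e) \<and> pathfinish (c e) = pos (tgt e)"
    and ends: "\<And>e. e \<in> E \<Longrightarrow> src e \<in> W \<and> tgt e \<in> W"
    and reach: "\<And>w. w \<in> W \<Longrightarrow> (adjG E src tgt)\<^sup>*\<^sup>* w r" and r: "r \<in> W"
  shows "connected (pos ` W \<union> (\<Union>e\<in>E. path_image (c e)))" (is "connected ?K")
proof -
  have edge: "connected_component ?K x y" if "e \<in> E" "x \<in> path_image (c e)" "y \<in> path_image (c e)" for e x y
    using that edges connected_path_image unfolding connected_component_def by blast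
  have ends_in: "pos (src e) \<in> path_image (c e)" "pos (tgt e) \<in> path_image (c e)" if "e \<in> E" for e
    using edges [OF that] pathstart_in_path_image pathfinish_in_path_image by metis+
  have vertex: "connected_component ?K (pos w) (pos r)" if "w \<in> W" for w
    using reach [OF that]
  proof (induction rule: converse_rtranclp_induct)
    case base
    then show ?case using r by auto
  next
    case (step u v)
    then have "connected_component ?K (pos u) (pos v)"
      unfolding adjG_def using edge ends_in by blast
    then show ?case using step.IH connected_component_trans by metis
  qed
  have "connected_component ?K x (pos r)" if "x \<in> ?K" for x
    using that vertex edge ends_in ends connected_component_trans by blast
  then show ?thesis
    unfolding connected_iff_connected_component
    by (meson connected_component_sym connected_component_trans)
qed

text \<open>With \<open>s\<close> put back, \<open>y\<close> is joined to the vertex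
  \<open>t\<close> outside \<open>U\<close>. The walk can leave \<open>U\<close> only through
  \<open>S\<close>, hence only at \<open>s\<close>, and until then each of its edges has an end in
  \<open>U\<close>.\<close>

lemma minimal_separator_reach:
  assumes min: "\<not> separating_set V E src tgt (S - {s})" and s: "s \<in> S" "S \<subseteq> V"
    and edges: "\<And>e. e \<in> E \<Longrightarrow> src e \<in> V \<and> tgt e \<in> V"
    and U: "U \<subseteq> V - S" "\<And>u v. u \<in> U \<Longrightarrow> v \<in> V - S \<Longrightarrow> adjG E src tgt u v \<Longrightarrow> v \<in> U"
    and y: "y \<in> U" and t: "t \<in> V - S - U"
  shows "(adjG {e \<in> E. src e \<in> U \<or> tgt e \<in> U} src tgt)\<^sup>*\<^sup>* y s" (is "?R\<^sup>*\<^sup>* y s")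
proof -
  have "y \<in> V - (S - {s})" "t \<in> V - (S - {s})" "S - {s} \<subseteq> V" using y t U s by auto
  then have "(\<lambda>a b. a \<notin> S - {s} \<and> b \<notin> S - {s} \<and> adjG E src tgt a b)\<^sup>*\<^sup>* y t"
    using min unfolding separating_set_def by blast
  \<comment> \<open>Invariant along the walk: \<open>s\<close> has been reached, or the walk is
    still inside \<open>U\<close>. At its end, \<open>t \<notin> U\<close> leaves only the first
    case.\<close>
  then have "?R\<^sup>*\<^sup>* y s \<or> (t \<in> U \<and> ?R\<^sup>*\<^sup>* y t)"
  proof (induction rule: rtranclp_induct)
    case base
    then show ?case using y by simp
  next
    case (step a b)
    show ?case
    proof (cases "?R\<^sup>*\<^sup>* y s")
      case False
      then have a: "a \<in> U" "?R\<^sup>*\<^sup>* y a" using step.IH by auto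
      then have "?R a b" using step.hyps unfolding adjG_def by blast
      then have yb: "?R\<^sup>*\<^sup>* y b" using a by simp
      then have "b \<noteq> s" using False by blast
      moreover have "b \<in> V" using step.hyps edges unfolding adjG_def by blast
      ultimately have "b \<in> U" using U(2) [OF a(1)] step.hyps by blast
      then show ?thesis using yb by blast
    qed simp
  qed
  then show ?thesis using t by blast
qed

text \<open>On a shortest path each vertex of \<open>S\<close> can be equal or adjacent only to vertices inside a
  window of three consecutive positions; as \<open>Z\<close> is independent, lengthening each window by one
  position makes the windows cover all but the first vertex of the path.\<close>
lemma short_path_in_dominated_set:
  fixes adj :: "'a \<Rightarrow> 'a \<Rightarrow> bool"
  assumes fin: "finite S" and SX: "S \<subseteq> X" and sym: "\<And>x y. adj x y \<Longrightarrow> adj y x"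
    and dom: "\<And>x. x \<in> X \<Longrightarrow> x \<in> S \<or> x \<in> Z \<or> (\<exists>s\<in>S. adj s x)"
    and indep: "\<And>x y. x \<in> Z \<Longrightarrow> y \<in> Z \<Longrightarrow> \<not> adj x y"
    and reach: "(\<lambda>a b. a \<in> X \<and> b \<in> X \<and> adj a b)\<^sup>*\<^sup>* x y" and x: "x \<in> X"
  shows "\<exists>ws. ws \<noteq> [] \<and> hd ws = x \<and> last ws = y \<and> set ws \<subseteq> X \<and> length ws \<le> 4 * card S + 1 \<and>
    (\<forall>i. Suc i < length ws \<longrightarrow> adj (ws ! i) (ws ! Suc i))"
proof -
  define R where "R = (\<lambda>a b. a \<in> X \<and> b \<in> X \<and> adj a b)"
  \<comment> \<open>The least length makes \<open>f\<close> below a shortest path in the subgraph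
    induced by \<open>X\<close>.\<close>
  define n where "n = (LEAST n. (R ^^ n) x y)"
  have "\<exists>n. (R ^^ n) x y" using reach unfolding R_def by (rule rtranclp_imp_relpowp)
  then have "(R ^^ n) x y" unfolding n_def by (rule LeastI_ex)
  then obtain f where f: "f 0 = x" "f n = y" "\<And>i. i < n \<Longrightarrow> R (f i) (f (Suc i))"
    by (auto simp: relpowp_fun_conv)
  have shortest: "n \<le> m" if "(R ^^ m) x y" for m
    using that unfolding n_def by (rule Least_le)
  have seg: "(R ^^ (j - i)) (f i) (f j)" if "i \<le> j" "j \<le> n" for i j
    unfolding relpowp_fun_conv using that f(3) by (intro exI [of _ "\<lambda>k. f (i + k)"]) auto
  have no_shortcut: "j - i \<le> m" if "i \<le> j" "j \<le> n" "(R ^^ m) (f i) (f j)" for i j m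
  proof -
    have "(R ^^ (i + (m + (n - j)))) x y"
      unfolding relpowp_add using that seg [of 0 i] seg [of j n] f by auto
    then show ?thesis using shortest that by fastforce
  qed
  have fX: "f i \<in> X" if "i \<le> n" for i
  proof (cases i)
    case 0
    then show ?thesis using x f by simp
  next
    case (Suc k)
    then show ?thesis using f(3) [of k] that by (simp add: R_def)
  qed
  define N where "N s = {i. i \<le> n \<and> (f i = s \<or> adj s (f i))}" for s
  have finN: "finite (N s)" for s by (simp add: N_def)
  \<comment> \<open>\<open>f i\<close> and \<open>f j\<close> are joined through \<open>s\<close> in
    at most two steps inside \<open>X\<close>, so a shortest path spends at most two steps between
    them.\<close>
  have window: "j \<le> i + 2" if s: "s \<in> S" and ij: "i \<in> N s" "j \<in> N s" for s i j
  proof (cases "i \<le> j")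
    case True
    have sX: "s \<in> X" using s SX by blast
    have ends: "f i \<in> X" "f j \<in> X" "j \<le> n" using ij fX by (auto simp: N_def)
    have "\<exists>m\<le>2. (R ^^ m) (f i) (f j)"
    proof -
      have i_s: "f i = s \<or> R (f i) s" and s_j: "f j = s \<or> R s (f j)"
        using ij sX ends sym by (auto simp: N_def R_def)
      then consider "f i = f j" | "R (f i) (f j)" | "R (f i) s" "R s (f j)" by auto
      then show ?thesis
      proof cases
        case 1
        then have "(R ^^ 0) (f i) (f j)" by simp
        then show ?thesis by blast
      next
        case 2
        then have "(R ^^ 1) (f i) (f j)" by (auto simp: OO_def)
        then show ?thesis by (meson one_le_numeral)
      next
        case 3
        then have "(R ^^ 2) (f i) (f j)" by (auto simp: numeral_2_eq_2 OO_def)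
        then show ?thesis by blast
      qed
    qed
    then show ?thesis using no_shortcut True ends by fastforce
  qed auto
  have near: "\<exists>s\<in>S. i \<in> N s" if "i \<le> n" "f i \<notin> Z" for i
    using dom [OF fX [OF that(1)]] that by (auto simp: N_def)
  \<comment> \<open>Four positions for each \<open>s\<close>: three from its window and one for a
    successor in \<open>Z\<close>. Position 0 may be left out because the \<open>n\<close> remaining
    positions already count the edges of the path.\<close>
  have "{1..n} \<subseteq> (\<Union>s\<in>S. {Min (N s)..Min (N s) + 3})"
  proof
    fix i assume i: "i \<in> {1..n}"
    have "\<exists>s\<in>S. \<exists>j\<in>N s. j \<le> i \<and> i \<le> j + 1"
    proof (cases "f i \<in> Z")
      case True
      have "R (f (i - 1)) (f i)" using f(3) [of "i - 1"] i by auto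
      then have "f (i - 1) \<notin> Z" using True indep by (auto simp: R_def)
      then obtain s where "s \<in> S" "i - 1 \<in> N s" using near [of "i - 1"] i by (metis atLeastAtMost_iff diff_le_self le_trans)
      then show ?thesis using i by (intro bexI [of _ s] bexI [of _ "i - 1"]) auto
    next
      case False
      then show ?thesis using near i by fastforce
    qed
    then obtain s j where s: "s \<in> S" "j \<in> N s" "j \<le> i" "i \<le> j + 1" by blast
    then have "Min (N s) \<in> N s" "Min (N s) \<le> j" using Min_in [OF finN [of s]] Min_le [OF finN] by blast+
    then show "i \<in> (\<Union>s\<in>S. {Min (N s)..Min (N s) + 3})"
      using s window [OF s(1) _ s(2)] by (intro UN_I [of s]) force+
  qed
  then have "card {1..n} \<le> card (\<Union>s\<in>S. {Min (N s)..Min (N s) + 3})"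
    using fin by (intro card_mono) auto
  also have "\<dots> \<le> (\<Sum>s\<in>S. card {Min (N s)..Min (N s) + 3})" by (rule card_UN_le [OF fin])
  also have "\<dots> = 4 * card S" by simp
  finally have n: "n \<le> 4 * card S" by simp
  let ?ws = "map f [0..<Suc n]"
  have "hd ?ws = x" "last ?ws = y" using f by (simp_all add: hd_map last_map del: upt_Suc)
  moreover have "set ?ws \<subseteq> X" using fX by (auto simp del: upt_Suc)
  moreover have "\<forall>i. Suc i < length ?ws \<longrightarrow> adj (?ws ! i) (?ws ! Suc i)"
    using f(3) by (auto simp: R_def simp del: upt_Suc)
  ultimately show ?thesis using n by (intro exI [of _ ?ws]) (auto simp del: upt_Suc)
qed

subsection \<open>Drawings cut by a minimal separating set\<close>

lemma one_plane_finite: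
  assumes "one_plane V E src tgt pos crv"
  shows "finite V" "finite E"
  using assms by (simp_all add: one_plane_def)

lemma one_plane_ends:
  assumes "one_plane V E src tgt pos crv" and "e \<in> E"
  shows "src e \<in> V \<and> tgt e \<in> V"
proof -
  have "\<forall>e\<in>E. src e \<in> V \<and> tgt e \<in> V \<and> src e \<noteq> tgt e"
    using assms(1) unfolding one_plane_def by (elim conjE)
  then show ?thesis using assms(2) by simp
qed

text \<open>\<open>U\<close> is a union of components of \<open>G - S\<close>. Minimality of
  \<open>S\<close> is recorded for the deletion of single vertices, and connectivity of
  \<open>G\<close> enters as \<open>S \<noteq> {}\<close>.\<close>

locale cut_drawing =
  fixes V :: "'v set" and E :: "'e set" and src tgt :: "'e \<Rightarrow> 'v"
    and pos :: "'v \<Rightarrow> complex" and crv :: "'e \<Rightarrow> real \<Rightarrow> complex"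
    and S U :: "'v set"
  assumes plane: "one_plane V E src tgt pos crv"
    and no_x: "no_x_crossings V E src tgt pos crv"
    and S: "S \<subseteq> V" "S \<noteq> {}"
    and U: "U \<subseteq> V - S" "U \<noteq> {}" "V - S - U \<noteq> {}"
    and U_closed: "\<And>u v. u \<in> U \<Longrightarrow> v \<in> V - S \<Longrightarrow> adjG E src tgt u v \<Longrightarrow> v \<in> U"
    and minimal: "\<And>s. s \<in> S \<Longrightarrow> \<not> separating_set V E src tgt (S - {s})"
begin

definition "W = V - S - U"
definition "EB = {e \<in> E. src e \<in> W \<or> tgt e \<in> W}"
definition "EA = E - EB"
definition "\<alpha> = pos ` (U \<union> S) \<union> (\<Union>e\<in>EA. path_image (crv e))"
definition "\<beta> = pos ` (W \<union> S) \<union> (\<Union>e\<in>EB. path_image (crv e))"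

abbreviation "Crossings \<equiv> all_crossings V E pos crv"
abbreviation "Faces \<equiv> faces V E pos crv"
abbreviation "ladj \<equiv> lam_adj V E src tgt pos crv"

definition "X = GV ` S \<union> CV ` (Crossings \<inter> \<alpha> \<inter> \<beta>) \<union>
  FV ` {F \<in> Faces. \<not> frontier F \<subseteq> \<alpha> \<and> \<not> frontier F \<subseteq> \<beta>}"
definition "A = GV ` U \<union> CV ` (Crossings - \<beta>) \<union> FV ` {F \<in> Faces. frontier F \<subseteq> \<alpha>}"
text \<open>The extra condition on faces leaves a face with frontier in
  \<open>\<alpha> \<inter> \<beta>\<close> to \<open>A\<close>, which keeps the sets
  disjoint.\<close>

definition "B = GV ` W \<union> CV ` (Crossings - \<alpha>) \<union>
  FV ` {F \<in> Faces. frontier F \<subseteq> \<beta> \<and> \<not> frontier F \<subseteq> \<alpha>}"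

section \<open>Basic facts about the two sides of the cut drawing\<close>

lemmas finV = one_plane_finite(1) [OF plane] and finE = one_plane_finite(2) [OF plane]
  and ends_V = one_plane_ends [OF plane]

lemma inj_pos: "inj_on pos V"
  using plane unfolding one_plane_def by (elim conjE)

lemma curve: "e \<in> E \<Longrightarrow> arc (crv e) \<and> pathstart (crv e) = pos (src e) \<and> pathfinish (crv e) = pos (tgt e) \<and>
   path_image (crv e) \<inter> pos ` V = {pos (src e), pos (tgt e)}"
proof (erule bspec [rotated])
  show "\<forall>e\<in>E. arc (crv e) \<and> pathstart (crv e) = pos (src e) \<and> pathfinish (crv e) = pos (tgt e) \<and>
   path_image (crv e) \<inter> pos ` V = {pos (src e), pos (tgt e)}"
    using plane unfolding one_plane_def by (elim conjE)
qed

lemma vertex_on_edge: "e \<in> E \<Longrightarrow> v \<in> V \<Longrightarrow> pos v \<in> path_image (crv e) \<Longrightarrow> v \<in> {src e, tgt e}"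
  using curve [of e] ends_V [of e] inj_onD [OF inj_pos] by blast

lemma crossing_unique:
  assumes "e \<in> E" "p \<in> crossings_of V E pos crv e" "q \<in> crossings_of V E pos crv e"
  shows "p = q"
proof -
  have "\<forall>e\<in>E. \<forall>p\<in>crossings_of V E pos crv e. \<forall>q\<in>crossings_of V E pos crv e. p = q"
    using plane unfolding one_plane_def by (elim conjE)
  then show ?thesis using assms by blast
qed

lemma V_split: "V = U \<union> S \<union> W" "U \<inter> S = {}" "U \<inter> W = {}" "S \<inter> W = {}"
  using S U unfolding W_def by auto

lemma E_split: "E = EA \<union> EB" "EA \<subseteq> E" "EB \<subseteq> E"
  unfolding EA_def EB_def by auto

lemma no_adj: "u \<in> U \<Longrightarrow> w \<in> W \<Longrightarrow> \<not> adjG E src tgt u w"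
  using U_closed unfolding W_def by blast

lemma EA_ends: "e \<in> EA \<Longrightarrow> src e \<in> U \<union> S \<and> tgt e \<in> U \<union> S"
  using ends_V V_split unfolding EA_def EB_def by blast

lemma EB_ends: "e \<in> EB \<Longrightarrow> src e \<in> W \<union> S \<and> tgt e \<in> W \<union> S"
proof -
  assume e: "e \<in> EB"
  then have "adjG E src tgt (src e) (tgt e)" "adjG E src tgt (tgt e) (src e)"
    unfolding adjG_def EB_def by blast+
  then show ?thesis using e no_adj ends_V V_split unfolding EB_def by blast
qed

lemma EA_mem: "e \<in> E \<Longrightarrow> src e \<in> U \<or> tgt e \<in> U \<Longrightarrow> e \<in> EA"
  using EB_ends V_split unfolding EA_def by blast

lemma D_eq: "pos ` V \<union> (\<Union>e\<in>E. path_image (crv e)) = \<alpha> \<union> \<beta>"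
  using V_split(1) E_split(1) unfolding \<alpha>_def \<beta>_def by blast

lemma Faces_eq: "Faces = components (- (\<alpha> \<union> \<beta>))"
  unfolding faces_def D_eq ..

lemma closed_sides: "closed \<alpha>" "closed \<beta>"
proof -
  have "finite (U \<union> S)" "finite (W \<union> S)" using finV V_split(1) by (auto intro: finite_subset)
  moreover have "finite EA" "finite EB" using finite_subset [OF _ finE] E_split(2,3) by blast+
  moreover have "closed (path_image (crv e))" if "e \<in> E" for e
    using curve [OF that] by (simp add: closed_arc_image)
  ultimately show "closed \<alpha>" "closed \<beta>"
    unfolding \<alpha>_def \<beta>_def using E_split(2,3)
    by (auto intro!: closed_Un closed_UN intro: finite_imp_closed)
qed

section \<open>Connectivity of the two sides\<close>

lemma U_reach: "u \<in> U \<Longrightarrow> s \<in> S \<Longrightarrow> (adjG EA src tgt)\<^sup>*\<^sup>* u s"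
proof -
  assume us: "u \<in> U" "s \<in> S"
  obtain t where "t \<in> V - S - U" using U(3) by blast
  then have "(adjG {e \<in> E. src e \<in> U \<or> tgt e \<in> U} src tgt)\<^sup>*\<^sup>* u s"
    using us S(1) U(1) U_closed ends_V minimal
    by (intro minimal_separator_reach [of V E src tgt S s U u t]) blast+
  then show ?thesis
    by (rule adjG_rtranclp_mono [rotated]) (use EA_mem in blast)
qed

lemma W_reach: "w \<in> W \<Longrightarrow> s \<in> S \<Longrightarrow> (adjG EB src tgt)\<^sup>*\<^sup>* w s"
proof -
  assume ws: "w \<in> W" "s \<in> S"
  obtain t where "t \<in> V - S - W" using U(1,2) unfolding W_def by blast
  moreover have "v \<in> W" if "u \<in> W" "v \<in> V - S" "adjG E src tgt u v" for u v
    using no_adj adjG_sym [OF that(3)] that unfolding W_def by blast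
  moreover have "W \<subseteq> V - S" unfolding W_def by blast
  ultimately show ?thesis
    unfolding EB_def using ws S(1) ends_V minimal
    by (intro minimal_separator_reach [of V E src tgt S s W w t]) blast+
qed

text \<open>By minimality every vertex of \<open>U\<close> reaches all of \<open>S\<close> along
  edges of \<open>EA\<close>, so any two vertices of \<open>S\<close> are joined through
  \<open>U\<close>; on the other side they are joined through \<open>W\<close>.\<close>

lemma connected_sides: "connected \<alpha>" "connected \<beta>"
proof -
  obtain s u w where suw: "s \<in> S" "u \<in> U" "w \<in> W" using S U unfolding W_def by blast
  have paths: "path (crv e) \<and> pathstart (crv e) = pos (src e) \<and> pathfinish (crv e) = pos (tgt e)"
    if "e \<in> E" for e
    using curve [OF that] by (simp add: arc_imp_path)
  have "(adjG EA src tgt)\<^sup>*\<^sup>* v s" if "v \<in> U \<union> S" for v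
    using that suw U_reach adjG_rtranclp_sym rtranclp_trans by (metis Un_iff)
  then show "connected \<alpha>" unfolding \<alpha>_def
    using paths E_split(2) EA_ends suw
    by (intro connected_drawing [where r = s and src = src and tgt = tgt]) blast+
  have "(adjG EB src tgt)\<^sup>*\<^sup>* v s" if "v \<in> W \<union> S" for v
    using that suw W_reach adjG_rtranclp_sym rtranclp_trans by (metis Un_iff)
  then show "connected \<beta>" unfolding \<beta>_def
    using paths E_split(3) EB_ends suw
    by (intro connected_drawing [where r = s and src = src and tgt = tgt]) blast+
qed

lemma pos_in_\<alpha>: "v \<in> V \<Longrightarrow> pos v \<in> \<alpha> \<longleftrightarrow> v \<in> U \<union> S"
proof
  assume v: "v \<in> V" and "pos v \<in> \<alpha>"
  then consider "pos v \<in> pos ` (U \<union> S)" | e where "e \<in> EA" "pos v \<in> path_image (crv e)"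
    unfolding \<alpha>_def by blast
  then show "v \<in> U \<union> S"
  proof cases
    case 1
    then show ?thesis using inj_onD [OF inj_pos] v V_split(1) by blast
  next
    case 2
    then show ?thesis using vertex_on_edge v EA_ends E_split by blast
  qed
qed (auto simp: \<alpha>_def)

lemma pos_in_\<beta>: "v \<in> V \<Longrightarrow> pos v \<in> \<beta> \<longleftrightarrow> v \<in> W \<union> S"
proof
  assume v: "v \<in> V" and "pos v \<in> \<beta>"
  then consider "pos v \<in> pos ` (W \<union> S)" | e where "e \<in> EB" "pos v \<in> path_image (crv e)"
    unfolding \<beta>_def by blast
  then show "v \<in> W \<union> S"
  proof cases
    case 1
    then show ?thesis using inj_onD [OF inj_pos] v V_split(1) by blast
  next
    case 2
    then show ?thesis using vertex_on_edge v EB_ends E_split by blast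
  qed
qed (auto simp: \<beta>_def)

section \<open>Common points of the two sides\<close>

lemma crossing_ends:
  assumes "e \<in> E" "f \<in> E" "e \<noteq> f" "p \<in> path_image (crv e) \<inter> path_image (crv f) - pos ` V"
  shows "p \<in> crossings_of V E pos crv e" "p \<in> Crossings"
proof -
  show "p \<in> crossings_of V E pos crv e" using assms unfolding crossings_of_def by auto
  then show "p \<in> Crossings" using assms(1) unfolding all_crossings_def by blast
qed

text \<open>A common point that is no vertex is a crossing of an edge of \<open>EA\<close> with an
  edge of \<open>EB\<close>. Some consecutive endpoints \<open>a\<close> and \<open>b\<close> of it
  are adjacent; as no edge joins \<open>U\<close> to \<open>W\<close>, one of them lies in
  \<open>S\<close>.\<close>

lemma sides_Int: "p \<in> \<alpha> \<inter> \<beta> \<Longrightarrow> p \<in> pos ` S \<or> (p \<in> Crossings - pos ` V \<and> (\<exists>s\<in>S. ladj (GV s) (CV p)))"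
proof (cases "p \<in> pos ` V")
  case True
  assume "p \<in> \<alpha> \<inter> \<beta>"
  then show ?thesis using True pos_in_\<alpha> pos_in_\<beta> V_split by blast
next
  case False
  assume p: "p \<in> \<alpha> \<inter> \<beta>"
  have "U \<union> S \<subseteq> V" "W \<union> S \<subseteq> V" using V_split(1) by auto
  then obtain e f where ef: "e \<in> EA" "f \<in> EB" "p \<in> path_image (crv e)" "p \<in> path_image (crv f)"
    using p False unfolding \<alpha>_def \<beta>_def by blast
  then have ne: "e \<in> E" "f \<in> E" "e \<noteq> f" unfolding EA_def EB_def by auto
  have cr: "p \<in> path_image (crv e) \<inter> path_image (crv f) - pos ` V" using ef False by blast
  obtain a b where ab: "a \<in> {src e, tgt e}" "b \<in> {src f, tgt f}" "adjG E src tgt a b"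
    using no_x ne cr unfolding no_x_crossings_def by blast
  then have "a \<in> S \<or> b \<in> S" using EA_ends [OF ef(1)] EB_ends [OF ef(2)] no_adj by blast
  moreover have "p \<in> crossings_of V E pos crv e" "p \<in> crossings_of V E pos crv f"
    using crossing_ends(1) [of e f p] crossing_ends(1) [of f e p] ne cr by blast+
  ultimately have "\<exists>s\<in>S. ladj (GV s) (CV p)"
    using ab ne unfolding lam_adj_def lam_adj0.simps by blast
  then show ?thesis using crossing_ends(2) [OF ne cr] False by blast
qed

lemma S_in_sides: "s \<in> S \<Longrightarrow> pos s \<in> \<alpha> \<inter> \<beta>"
  unfolding \<alpha>_def \<beta>_def by blast

lemma crossing_props:
  assumes "p \<in> Crossings"
  shows "p \<in> \<alpha> \<union> \<beta>" "p \<notin> pos ` V"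
  using assms unfolding D_eq [symmetric] all_crossings_def crossings_of_def by blast+

lemma finite_Crossings: "finite Crossings"
proof -
  have "finite (crossings_of V E pos crv e)" if e: "e \<in> E" for e
  proof (cases "crossings_of V E pos crv e = {}")
    case False
    then obtain p where "p \<in> crossings_of V E pos crv e" by blast
    then have "crossings_of V E pos crv e \<subseteq> {p}" using crossing_unique [OF e] by blast
    then show ?thesis by (rule finite_subset) simp
  qed simp
  then show ?thesis using finE unfolding all_crossings_def by blast
qed

text \<open>With vertices and crossings as \<open>M\<close>, edges end in \<open>M\<close> and meet
  each other only there.\<close>

lemma near: "p \<in> \<alpha> \<inter> \<beta> \<Longrightarrow>
  \<exists>r>0. \<forall>F\<in>components (- (\<alpha> \<union> \<beta>)). F \<inter> ball p r \<noteq> {} \<longrightarrow> p \<in> frontier F"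
proof (rule face_near_vertex [where M = "pos ` V \<union> Crossings" and E = E and c = crv])
  show "finite (pos ` V \<union> Crossings)" using finV finite_Crossings by simp
  show "path_image (crv e) \<inter> path_image (crv f) \<subseteq> pos ` V \<union> Crossings"
    if "e \<in> E" "f \<in> E" "e \<noteq> f" for e f
    using crossing_ends(2) [OF that] by blast
  show "\<alpha> \<union> \<beta> = pos ` V \<union> Crossings \<union> (\<Union>e\<in>E. path_image (crv e))"
    unfolding D_eq [symmetric] all_crossings_def crossings_of_def by blast
  show "p \<in> pos ` V \<union> Crossings" if "p \<in> \<alpha> \<inter> \<beta>"
    using sides_Int [OF that] S by blast
qed (use finE curve ends_V in auto)

section \<open>Connectivity and diameter of \<open>X\<close> in the radial planarization\<close>

definition "lnode p = (if p \<in> pos ` V then GV (inv_into V pos p) else CV p)"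

lemma lnode_in_X: "p \<in> \<alpha> \<inter> \<beta> \<Longrightarrow> lnode p \<in> X"
proof -
  assume p: "p \<in> \<alpha> \<inter> \<beta>"
  show ?thesis
  proof (cases "p \<in> pos ` V")
    case True
    then obtain s where "s \<in> S" "p = pos s" using sides_Int [OF p] by blast
    then show ?thesis using True S inv_into_f_f [OF inj_pos] by (auto simp: lnode_def X_def)
  next
    case False
    then show ?thesis using sides_Int [OF p] p S by (auto simp: lnode_def X_def)
  qed
qed

lemma lnode_pos: "s \<in> S \<Longrightarrow> lnode (pos s) = GV s"
  using S inv_into_f_f [OF inj_pos] by (auto simp: lnode_def)

lemma lnode_face: "p \<in> \<alpha> \<inter> \<beta> \<Longrightarrow> F \<in> Faces \<Longrightarrow> p \<in> frontier F \<Longrightarrow> ladj (lnode p) (FV F)"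
  using sides_Int [of p] S inv_into_into [of p pos V] f_inv_into_f [of p pos V]
  unfolding lnode_def lam_adj_def by auto

definition "lstep a b \<longleftrightarrow> a \<in> X \<and> b \<in> X \<and> ladj a b"

text \<open>Let \<open>I\<close> be the points whose nodes are reachable from \<open>s\<close>, and
  \<open>J\<close> the rest of \<open>\<alpha> \<inter> \<beta>\<close>. If \<open>J\<close> were
  nonempty, a linking face, which belongs to \<open>X\<close>, would carry reachability from
  \<open>I\<close> to \<open>J\<close>.\<close>

lemma lnodes_connected:
  assumes s: "s \<in> S" and p: "p \<in> \<alpha> \<inter> \<beta>"
  shows "lstep\<^sup>*\<^sup>* (GV s) (lnode p)"
proof (rule ccontr)
  assume not: "\<not> ?thesis"
  define I where "I = {p \<in> \<alpha> \<inter> \<beta>. lstep\<^sup>*\<^sup>* (GV s) (lnode p)}"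
  define J where "J = \<alpha> \<inter> \<beta> - I"
  have fin: "finite (\<alpha> \<inter> \<beta>)"
    using sides_Int finV finite_Crossings finite_subset [OF S(1)]
    by (intro finite_subset [of "\<alpha> \<inter> \<beta>" "pos ` S \<union> Crossings"]) auto
  have IJ: "\<alpha> \<inter> \<beta> = I \<union> J" "I \<inter> J = {}" by (auto simp: I_def J_def)
  then have "finite I" "finite J" using fin by auto
  moreover have "pos s \<in> I" using s S_in_sides lnode_pos by (simp add: I_def)
  moreover have "p \<in> J" using p not by (simp add: I_def J_def)
  ultimately have "\<exists>F\<in>components (- (\<alpha> \<union> \<beta>)). \<not> frontier F \<subseteq> \<alpha> \<and> \<not> frontier F \<subseteq> \<beta> \<and>
     frontier F \<inter> I \<noteq> {} \<and> frontier F \<inter> J \<noteq> {}"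
    using IJ by (intro linking_face closed_sides connected_sides near) blast+
  then obtain F q r where F: "F \<in> Faces" "\<not> frontier F \<subseteq> \<alpha>" "\<not> frontier F \<subseteq> \<beta>"
    and q: "q \<in> frontier F" "q \<in> I" and r: "r \<in> frontier F" "r \<in> J"
    unfolding Faces_eq by blast
  have qr: "q \<in> \<alpha> \<inter> \<beta>" "r \<in> \<alpha> \<inter> \<beta>" using q r by (auto simp: I_def J_def)
  have "FV F \<in> X" using F by (auto simp: X_def)
  then have "lstep (lnode q) (FV F)" "lstep (FV F) (lnode r)"
    using lnode_in_X qr lnode_face F(1) q(1) r(1) lam_adj_sym unfolding lstep_def by blast+
  moreover have "lstep\<^sup>*\<^sup>* (GV s) (lnode q)" using q(2) by (simp add: I_def)
  ultimately have "lstep\<^sup>*\<^sup>* (GV s) (lnode r)" by simp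
  then show False using r(2) qr(2) unfolding I_def J_def by blast
qed

lemma X_connected:
  assumes s: "s \<in> S" and x: "x \<in> X"
  shows "lstep\<^sup>*\<^sup>* (GV s) x"
proof -
  consider v where "v \<in> S" "x = GV v" | p where "p \<in> Crossings \<inter> \<alpha> \<inter> \<beta>" "x = CV p"
    | F where "F \<in> Faces" "\<not> frontier F \<subseteq> \<alpha>" "\<not> frontier F \<subseteq> \<beta>" "x = FV F"
    using x unfolding X_def by blast
  then show ?thesis
  proof cases
    case 1
    then show ?thesis using lnodes_connected [OF s S_in_sides] lnode_pos by metis
  next
    case 2
    then have "lnode p = x" using crossing_props by (simp add: lnode_def)
    then show ?thesis using lnodes_connected [OF s, of p] 2 by auto
  next
    case 3
    have F: "F \<in> components (- (\<alpha> \<union> \<beta>))" using 3 Faces_eq by simp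
    have "connected (\<alpha> \<union> \<beta>)"
      using connected_sides S_in_sides [OF s] by (intro connected_Un) auto
    \<comment> \<open>A connected frontier covered by the closed sets \<open>\<alpha>\<close> and
      \<open>\<beta>\<close>, but by neither alone, meets their intersection; this attaches the face
      to a node already reached.\<close>
    then have "connected (frontier F)"
      using connected_frontier_component_complement F by blast
    moreover have "frontier F \<subseteq> \<alpha> \<union> \<beta>"
      using frontier_of_components_closed_complement [OF _ F] closed_sides by blast
    ultimately obtain q where q: "q \<in> \<alpha> \<inter> \<beta>" "q \<in> frontier F"
      using closed_sides 3(2,3) unfolding connected_closed by blast
    then have "lstep (lnode q) x"
      using lnode_in_X lnode_face 3 x unfolding lstep_def by blast
    then show ?thesis using lnodes_connected [OF s q(1)] by simp
  qed
qed

lemma lstep_rtranclp_sym: "lstep\<^sup>*\<^sup>* x y \<Longrightarrow> lstep\<^sup>*\<^sup>* y x"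
  by (induction rule: rtranclp_induct)
    (auto simp: lstep_def intro: lam_adj_sym converse_rtranclp_into_rtranclp)

text \<open>The faces form the independent set \<open>Z\<close>, and every crossing in
  \<open>X\<close> has a neighbor in \<open>S\<close>.\<close>

lemma X_diameter: "induced_diam_le V E src tgt pos crv X (4 * card S)"
proof -
  obtain s where s: "s \<in> S" using S by blast
  have path: "\<exists>ws. ws \<noteq> [] \<and> hd ws = x \<and> last ws = y \<and> set ws \<subseteq> X \<and>
      length ws \<le> 4 * card (GV ` S :: 'v lvert set) + 1 \<and>
      (\<forall>i. Suc i < length ws \<longrightarrow> ladj (ws ! i) (ws ! Suc i))"
    if xy: "x \<in> X" "y \<in> X" for x y
  proof (rule short_path_in_dominated_set [where Z = "range FV"])
    show "finite (GV ` S :: 'v lvert set)" using finV S finite_subset by blast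
    show "GV ` S \<subseteq> X" by (auto simp: X_def)
    show "ladj b a" if "ladj a b" for a b using that by (rule lam_adj_sym)
    show "z \<in> GV ` S \<or> z \<in> range FV \<or> (\<exists>s\<in>GV ` S. ladj s z)" if "z \<in> X" for z
      using that sides_Int crossing_props S unfolding X_def by blast
    show "\<not> ladj a b" if "a \<in> range FV" "b \<in> range FV" for a b
      using that by (auto simp: lam_adj_def)
    have "lstep\<^sup>*\<^sup>* x y"
      using X_connected [OF s] xy lstep_rtranclp_sym rtranclp_trans by metis
    then show "(\<lambda>a b. a \<in> X \<and> b \<in> X \<and> ladj a b)\<^sup>*\<^sup>* x y"
      unfolding lstep_def [abs_def] .
    show "x \<in> X" by fact
  qed
  have "card (GV ` S :: 'v lvert set) = card S" by (intro card_image inj_onI) simp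
  then show ?thesis using path unfolding induced_diam_le_def by simp
qed

section \<open>The co-separating triple\<close>

lemma U_edge: "u \<in> U \<Longrightarrow> e \<in> E \<Longrightarrow> u \<in> {src e, tgt e} \<Longrightarrow> path_image (crv e) \<subseteq> \<alpha>"
  using EA_mem unfolding \<alpha>_def by blast

lemma W_edge: "w \<in> W \<Longrightarrow> e \<in> E \<Longrightarrow> w \<in> {src e, tgt e} \<Longrightarrow> path_image (crv e) \<subseteq> \<beta>"
  unfolding \<beta>_def EB_def by blast

lemma crossing_on_edge: "p \<in> crossings_of V E pos crv e \<Longrightarrow> p \<in> path_image (crv e)"
  unfolding crossings_of_def by blast

text \<open>All edges at \<open>U\<close> are drawn in \<open>\<alpha>\<close>, away from the
  crossings of \<open>B\<close>, and a face of \<open>A\<close> has its frontier in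
  \<open>\<alpha>\<close>, away from the vertices and crossings of \<open>B\<close>. The remaining
  cases exchange the sides or pair nodes of a kind that is never adjacent.\<close>

lemma A_B_nonadjacent:
  assumes a: "a \<in> A" and b: "b \<in> B"
  shows "\<not> ladj a b"
proof
  assume adj: "ladj a b"
  have posU: "pos u \<notin> \<beta>" if "u \<in> U" for u
    using that pos_in_\<beta> V_split by blast
  have posW: "pos w \<notin> \<alpha>" if "w \<in> W" for w
    using that pos_in_\<alpha> V_split by blast
  consider u where "u \<in> U" "a = GV u" | p where "p \<in> Crossings" "p \<notin> \<beta>" "a = CV p"
    | F where "frontier F \<subseteq> \<alpha>" "a = FV F"
    using a unfolding A_def by blast
  then show False
  proof cases
    case a1: 1
    consider w where "w \<in> W" "b = GV w" | p where "p \<notin> \<alpha>" "b = CV p"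
      | F where "frontier F \<subseteq> \<beta>" "b = FV F"
      using b unfolding B_def by blast
    then show False
    proof cases
      case 1
      then have "adjG E src tgt u w"
        using adj a1 unfolding lam_adj_def adjG_def by (auto simp: doubleton_eq_iff)
      then show False using no_adj a1 1 by blast
    next
      case 2
      then obtain e where "e \<in> E" "u \<in> {src e, tgt e}" "p \<in> crossings_of V E pos crv e"
        using adj a1 unfolding lam_adj_def by auto
      then show False using U_edge [OF a1(1)] crossing_on_edge 2 by blast
    next
      case 3
      then show False using adj a1 posU unfolding lam_adj_def by auto
    qed
  next
    case a2: 2
    consider w where "w \<in> W" "b = GV w" | q where "b = CV q"
      | F where "frontier F \<subseteq> \<beta>" "b = FV F"
      using b unfolding B_def by blast
    then show False
    proof cases
      case 1
      then obtain e where "e \<in> E" "w \<in> {src e, tgt e}" "p \<in> crossings_of V E pos crv e"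
        using adj a2 unfolding lam_adj_def by auto
      then show False using W_edge [OF 1(1)] crossing_on_edge a2 by blast
    next
      case 2
      then show False using adj a2 unfolding lam_adj_def by auto
    next
      case 3
      then show False using adj a2 unfolding lam_adj_def by auto
    qed
  next
    case a3: 3
    consider w where "w \<in> W" "b = GV w" | q where "q \<notin> \<alpha>" "b = CV q" | G where "b = FV G"
      using b unfolding B_def by blast
    then show False
      using adj a3 posW unfolding lam_adj_def by cases auto
  qed
qed

lemma co_separating: "co_separating_triple V E src tgt pos crv A X B"
proof -
  have "Crossings = (Crossings - \<beta>) \<union> (Crossings \<inter> \<alpha> \<inter> \<beta>) \<union> (Crossings - \<alpha>)"
    using crossing_props(1) by blast
  then have C: "CV ` Crossings = CV ` (Crossings - \<beta>) \<union> CV ` (Crossings \<inter> \<alpha> \<inter> \<beta>) \<union> CV ` (Crossings - \<alpha>)"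
    by blast
  have G: "GV ` V = GV ` U \<union> GV ` S \<union> GV ` W"
    using V_split(1) by blast
  have F: "FV ` Faces = FV ` ({F \<in> Faces. frontier F \<subseteq> \<alpha>} \<union>
      {F \<in> Faces. \<not> frontier F \<subseteq> \<alpha> \<and> \<not> frontier F \<subseteq> \<beta>} \<union>
      {F \<in> Faces. frontier F \<subseteq> \<beta> \<and> \<not> frontier F \<subseteq> \<alpha>})"
    by (rule arg_cong) blast
  have "A \<union> X \<union> B = lam_verts V E pos crv"
    unfolding A_def X_def B_def lam_verts_def C G F by (simp only: image_Un Un_ac)
  moreover have "A \<inter> X = {}" "A \<inter> B = {}" "X \<inter> B = {}"
    using V_split crossing_props(1) unfolding A_def X_def B_def by blast+
  moreover have "\<exists>v\<in>V. GV v \<in> A" "\<exists>v\<in>V. GV v \<in> X" "\<exists>v\<in>V. GV v \<in> B"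
    using S U V_split(1) unfolding A_def X_def B_def W_def by blast+
  moreover have "\<not> adjG E src tgt u v" if "GV u \<in> A" "GV v \<in> B" for u v
    using that no_adj unfolding A_def B_def by blast
  ultimately show ?thesis
    unfolding co_separating_triple_def using A_B_nonadjacent by blast
qed

lemma X_vertices: "{v \<in> V. GV v \<in> X} = S"
  using S unfolding X_def by blast

end

section \<open>From separating sets to triples and back\<close>

lemma cut_drawing_exists:
  assumes "one_plane V E src tgt pos crv" "connected_graph V E src tgt"
    and "no_x_crossings V E src tgt pos crv"
    and sep: "separating_set V E src tgt S0"
  obtains S U where "cut_drawing V E src tgt pos crv S U" "card S \<le> card S0"
proof -
  \<comment> \<open>A separating set of least size, so that deleting any of its vertices leaves a
    set that does not separate.\<close>
  define S where "S = (ARG_MIN card S. separating_set V E src tgt S)"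
  have S: "separating_set V E src tgt S"
    unfolding S_def using sep by (rule arg_min_natI)
  have le: "card S \<le> card T" if "separating_set V E src tgt T" for T
    unfolding S_def using that by (rule arg_min_nat_le)
  let ?R = "\<lambda>x y. x \<notin> S \<and> y \<notin> S \<and> adjG E src tgt x y"
  obtain a b where SV: "S \<subseteq> V" and ab: "a \<in> V - S" "b \<in> V - S" "\<not> ?R\<^sup>*\<^sup>* a b"
    using S unfolding separating_set_def by blast
  have finS: "finite S" using finite_subset [OF SV one_plane_finite(1) [OF assms(1)]] .
  \<comment> \<open>The component of \<open>a\<close> in \<open>G - S\<close>; the vertex
    \<open>b\<close> lies outside it.\<close>
  define U where "U = {v \<in> V - S. ?R\<^sup>*\<^sup>* a v}"
  have "cut_drawing V E src tgt pos crv S U"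
  proof
    show "S \<noteq> {}"
    proof
      assume "S = {}"
      then show False using ab assms(2) unfolding connected_graph_def by simp
    qed
    show "U \<subseteq> V - S" "U \<noteq> {}" "V - S - U \<noteq> {}" using ab by (auto simp: U_def)
    show "v \<in> U" if "u \<in> U" "v \<in> V - S" "adjG E src tgt u v" for u v
    proof -
      have "?R u v" "?R\<^sup>*\<^sup>* a u" using that by (auto simp: U_def)
      then have "?R\<^sup>*\<^sup>* a v" by (simp add: rtranclp.rtrancl_into_rtrancl)
      then show ?thesis using that by (simp add: U_def)
    qed
    show "\<not> separating_set V E src tgt (S - {s})" if "s \<in> S" for s
      using le [of "S - {s}"] card_Diff1_less [OF finS that] by linarith
  qed (use assms SV in auto)
  then show ?thesis using that le [OF sep] by blast
qed

text \<open>A walk in \<open>G\<close> that starts in \<open>A\<close> and avoids \<open>X\<close>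
  never enters \<open>B\<close>, since no edge of \<open>G\<close> joins \<open>A\<close> to
  \<open>B\<close>.\<close>

lemma separating_set_of_triple:
  assumes ends: "\<And>e. e \<in> E \<Longrightarrow> src e \<in> V \<and> tgt e \<in> V"
    and triple: "co_separating_triple V E src tgt pos crv A X B"
  shows "separating_set V E src tgt {v \<in> V. GV v \<in> X}" (is "separating_set _ _ _ _ ?S")
proof -
  have cover: "GV v \<in> A \<union> X \<union> B" if "v \<in> V" for v
    using triple that unfolding co_separating_triple_def lam_verts_def by blast
  obtain a b where ab: "a \<in> V" "GV a \<in> A" "b \<in> V" "GV b \<in> B"
    using triple unfolding co_separating_triple_def by blast
  have disj: "A \<inter> X = {}" "A \<inter> B = {}" "X \<inter> B = {}"
    and no: "\<And>u v. GV u \<in> A \<Longrightarrow> GV v \<in> B \<Longrightarrow> \<not> adjG E src tgt u v"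
    using triple unfolding co_separating_triple_def by blast+
  have "GV z \<in> A" if "(\<lambda>x y. x \<notin> ?S \<and> y \<notin> ?S \<and> adjG E src tgt x y)\<^sup>*\<^sup>* a z" for z
    using that
  proof (induction rule: rtranclp_induct)
    case (step y z)
    then have "z \<in> V" using ends unfolding adjG_def by blast
    then show ?case using step no cover by blast
  qed (rule ab(2))
  then show ?thesis unfolding separating_set_def using ab disj by blast
qed

theorem theorem2:
  fixes V :: "'v set" and E :: "'e set" and src tgt :: "'e \<Rightarrow> 'v"
    and pos :: "'v \<Rightarrow> complex" and crv :: "'e \<Rightarrow> real \<Rightarrow> complex" and k :: nat
  assumes "one_plane V E src tgt pos crv"
    and "connected_graph V E src tgt"
    and "no_x_crossings V E src tgt pos crv"
    and "kite_assumption V E src tgt pos crv"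
    and "k \<ge> 1"
  shows "(\<exists>S. separating_set V E src tgt S \<and> card S \<le> k) \<longleftrightarrow>
         (\<exists>A X B. co_separating_triple V E src tgt pos crv A X B \<and>
            card {v \<in> V. GV v \<in> X} \<le> k \<and>
            induced_diam_le V E src tgt pos crv X (4 * k))"
proof
  assume "\<exists>S. separating_set V E src tgt S \<and> card S \<le> k"
  then obtain S U where cut: "cut_drawing V E src tgt pos crv S U" and card: "card S \<le> k"
    using cut_drawing_exists [OF assms(1-3)] by (metis order_trans)
  interpret cut_drawing V E src tgt pos crv S U by (rule cut)
  \<comment> \<open>The bound \<open>4 * card S\<close> weakens to \<open>4 * k\<close>.\<close>
  have "induced_diam_le V E src tgt pos crv X (4 * k)"
    using X_diameter card unfolding induced_diam_le_def
    by (meson add_mono_thms_linordered_semiring(3) mult_le_mono2 order_trans)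
  then show "\<exists>A X B. co_separating_triple V E src tgt pos crv A X B \<and>
      card {v \<in> V. GV v \<in> X} \<le> k \<and> induced_diam_le V E src tgt pos crv X (4 * k)"
    using co_separating X_vertices card by metis
next
  assume "\<exists>A X B. co_separating_triple V E src tgt pos crv A X B \<and>
      card {v \<in> V. GV v \<in> X} \<le> k \<and> induced_diam_le V E src tgt pos crv X (4 * k)"
  then obtain A X B where triple: "co_separating_triple V E src tgt pos crv A X B"
    and card: "card {v \<in> V. GV v \<in> X} \<le> k" by blast
  have "separating_set V E src tgt {v \<in> V. GV v \<in> X}"
    using one_plane_ends [OF assms(1)] triple by (rule separating_set_of_triple)
  then show "\<exists>S. separating_set V E src tgt S \<and> card S \<le> k" using card by blast
qed

end
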